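(* Let $X$ be a (real) Banach space. The following assertions are equivalent: (1) $X$ contains no isomorphic copy of $\ell_1$. (2) The closed unit ball $B_X$ is Fréchet-Urysohn in the weak topology. (3) There is a sequence $(F_n)_{n=1}^\infty$ of weakly closed subsets of $X$ which are Fréchet-Urysohn in the weak topology such that $X=\bigcup_{n=1}^\infty F_n$.
   Context: A topological space $S$ is Fréchet-Urysohn if whenever $A\subset S$ and $x\in\overline{A}$ (closure in $S$), there is a sequence $(x_n)$ in $A$ with $x_n\to x$. A subset of $X$ is Fréchet-Urysohn in the weak topology if it is so as a subspace of $(X,\sigma(X,X^* ))$. $X$ contains an isomorphic copy of $\ell_1$ if some linear subspace of $X$ is linearly homeomorphic to $\ell_1$. *)

theory Defs
  imports "HOL-Analysis.Analysis"
begin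

definition weak_topology :: "'a::real_normed_vector topology" where
  "weak_topology =
     topology_generated_by {f -` U | (f :: 'a \<Rightarrow> real) U. bounded_linear f \<and> open U}"

lemma topspace_weak_topology [simp]: "topspace weak_topology = UNIV"
proof -
  have "(UNIV :: 'a set) = (\<lambda>_. 0 :: real) -` UNIV" by simp
  then have "(UNIV :: 'a set) \<in> {f -` U | (f :: 'a \<Rightarrow> real) U. bounded_linear f \<and> open U}"
    using bounded_linear_zero open_UNIV by blast
  then show ?thesis
    unfolding weak_topology_def topology_generated_by_topspace by blast
qed

definition frechet_urysohn_space :: "'a topology \<Rightarrow> bool" where
  "frechet_urysohn_space S \<longleftrightarrow>
     (\<forall>A x. A \<subseteq> topspace S \<and> x \<in> S closure_of A \<longrightarrow>
        (\<exists>s. range s \<subseteq> A \<and> limitin S s x sequentially))"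

definition weakly_frechet_urysohn :: "'a::real_normed_vector set \<Rightarrow> bool" where
  "weakly_frechet_urysohn F \<longleftrightarrow> frechet_urysohn_space (subtopology weak_topology F)"

typedef ell1 = "{x :: nat \<Rightarrow> real. summable (\<lambda>n. \<bar>x n\<bar>)}"
  morphisms ell1_nth Abs_ell1
  by (rule exI[of _ "\<lambda>_. 0"]) simp

setup_lifting type_definition_ell1

lemma summable_abs_ell1_nth: "summable (\<lambda>n. \<bar>ell1_nth x n\<bar>)"
  using ell1_nth[of x] by simp

lemma summable_abs_add:
  fixes x y :: "nat \<Rightarrow> real"
  assumes "summable (\<lambda>n. \<bar>x n\<bar>)" "summable (\<lambda>n. \<bar>y n\<bar>)"
  shows "summable (\<lambda>n. \<bar>x n + y n\<bar>)"
  by (rule summable_comparison_test'[OF summable_add[OF assms], where N = 0])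
    (simp add: abs_triangle_ineq)

instantiation ell1 :: real_vector
begin

lift_definition zero_ell1 :: ell1 is "\<lambda>_. 0" by simp

lift_definition plus_ell1 :: "ell1 \<Rightarrow> ell1 \<Rightarrow> ell1" is "\<lambda>x y n. x n + y n"
  by (rule summable_abs_add)

lift_definition uminus_ell1 :: "ell1 \<Rightarrow> ell1" is "\<lambda>x n. - x n" by simp

lift_definition minus_ell1 :: "ell1 \<Rightarrow> ell1 \<Rightarrow> ell1" is "\<lambda>x y n. x n - y n"
  by (rule summable_abs_add[where y = "\<lambda>n. - y n" for y, simplified])

lift_definition scaleR_ell1 :: "real \<Rightarrow> ell1 \<Rightarrow> ell1" is "\<lambda>c x n. c * x n"
  by (simp add: abs_mult summable_mult)

instance
  by standard (transfer; simp add: algebra_simps fun_eq_iff)+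

end

instantiation ell1 :: real_normed_vector
begin

lift_definition norm_ell1 :: "ell1 \<Rightarrow> real" is "\<lambda>x. \<Sum>n. \<bar>x n\<bar>" .

definition sgn_ell1 :: "ell1 \<Rightarrow> ell1" where
  "sgn_ell1 x = x /\<^sub>R norm x"

definition dist_ell1 :: "ell1 \<Rightarrow> ell1 \<Rightarrow> real" where
  "dist_ell1 x y = norm (x - y)"

definition uniformity_ell1 :: "(ell1 \<times> ell1) filter" where
  "uniformity_ell1 = (INF e\<in>{0 <..}. principal {(x, y). dist x y < e})"

definition open_ell1 :: "ell1 set \<Rightarrow> bool" where
  "open_ell1 S = (\<forall>x\<in>S. \<forall>\<^sub>F (x', y) in uniformity. x' = x \<longrightarrow> y \<in> S)"

instance
proof
  fix x y :: ell1 and c :: real and S :: "ell1 set"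
  show "dist x y = norm (x - y)" by (rule dist_ell1_def)
  show "sgn x = x /\<^sub>R norm x" by (rule sgn_ell1_def)
  show "uniformity = (INF e\<in>{0 <..}. principal {(x :: ell1, y). dist x y < e})"
    by (rule uniformity_ell1_def)
  show "open S = (\<forall>x\<in>S. \<forall>\<^sub>F (x', y) in uniformity. x' = x \<longrightarrow> y \<in> S)"
    by (rule open_ell1_def)
  show "norm x = 0 \<longleftrightarrow> x = 0"
    by transfer (simp add: suminf_eq_zero_iff fun_eq_iff)
  show "norm (x + y) \<le> norm x + norm y"
  proof transfer
    fix x y :: "nat \<Rightarrow> real"
    assume *: "summable (\<lambda>n. \<bar>x n\<bar>)" "summable (\<lambda>n. \<bar>y n\<bar>)"
    have "summable (\<lambda>n. \<bar>x n + y n\<bar>)"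
      using * by (rule summable_abs_add)
    with * show "(\<Sum>n. \<bar>x n + y n\<bar>) \<le> (\<Sum>n. \<bar>x n\<bar>) + (\<Sum>n. \<bar>y n\<bar>)"
      by (subst suminf_add) (auto intro!: suminf_le summable_add abs_triangle_ineq)
  qed
  show "norm (c *\<^sub>R x) = \<bar>c\<bar> * norm x"
    by transfer (simp add: abs_mult suminf_mult)
qed

end

definition contains_copy_of_ell1 :: "'a::real_normed_vector itself \<Rightarrow> bool" where
  "contains_copy_of_ell1 _ \<longleftrightarrow>
     (\<exists>(Y :: 'a set) (f :: ell1 \<Rightarrow> 'a) g.
        subspace Y \<and> linear f \<and> homeomorphism UNIV Y f g)"

end

theory Submission
  imports Defs
begin

text \<open>
  For \<open>(1) \<Longrightarrow> (2)\<close> let \<open>0\<close> be in the weak closure of a bounded set \<open>M\<close>, and call a subset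
  clustering if its weak closure still contains \<open>0\<close>. By compactness of the finite powers of the
  dual ball \<open>K\<close>, every decreasing sequence of clustering sets has a countable clustering
  pseudo-intersection. If for every \<open>e > 0\<close> every clustering set can be refined to a clustering set
  on which each \<open>\<phi> \<in> K\<close> is below \<open>e\<close> up to finitely many exceptions, a diagonal argument gives a weakly null
  sequence (\<open>K\<close> is symmetric). Otherwise fix a bad \<open>e\<close>; call a region of \<open>K\<close> cut out by finitely many
  conditions \<open>\<phi> x \<ge> e\<close> and \<open>\<phi> x \<le> e/2\<close> large if some \<open>\<phi>\<close> in it has infinitely many exceptions. For
  finitely many large regions, the set of those \<open>x\<close> for which one of the two conditions at \<open>x\<close>
  destroys largeness of one of them is not clustering, so \<open>x\<close> can be chosen to keep everything large.
  This yields a sequence for which all patterns of conditions are realised, and such a bounded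
  sequence spans a copy of \<open>\<ell>\<^sub>1\<close>.

  Conversely, in a copy of \<open>\<ell>\<^sub>1\<close> the differences \<open>e\<^sub>i - e\<^sub>j\<close> with \<open>i < j\<close> have \<open>0\<close> in their weak
  closure by the pigeonhole principle, but no sequence of them is weakly null, as a suitable \<open>0/1\<close>
  functional shows; this excludes (2), and together with Baire's theorem also (3).
\<close>

subsection \<open>The Hahn--Banach theorem\<close>

text \<open>Homogeneity is asked only as an inequality, which is easier to verify for infima;
  equality follows in \<open>sublinear_scale\<close>.\<close>

definition sublinear :: "('a::real_vector \<Rightarrow> real) \<Rightarrow> bool" where
  "sublinear q \<longleftrightarrow> (\<forall>x y. q (x + y) \<le> q x + q y) \<and> (\<forall>t>0. \<forall>x. q (t *\<^sub>R x) \<le> t * q x)"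

lemma sublinear_add: "sublinear q \<Longrightarrow> q (x + y) \<le> q x + q y"
  by (simp add: sublinear_def)

lemma sublinear_0:
  assumes "sublinear q" shows "q 0 = 0"
proof -
  have "q (t *\<^sub>R 0) \<le> t * q 0" if "t > 0" for t
    using assms that unfolding sublinear_def by blast
  from this[of "1/2"] this[of 2] have "q 0 \<le> (1/2) * q 0" "q 0 \<le> 2 * q 0"
    by simp_all
  then show ?thesis by linarith
qed

lemma sublinear_scale:
  assumes "sublinear q" "t \<ge> 0" shows "q (t *\<^sub>R x) = t * q x"
proof (cases "t = 0")
  case True
  then show ?thesis by (simp add: sublinear_0 assms)
next
  case False
  then have t: "t > 0" using assms by simp
  then have "q (inverse t *\<^sub>R (t *\<^sub>R x)) \<le> inverse t * q (t *\<^sub>R x)"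
    using assms(1) unfolding sublinear_def by (meson inverse_positive_iff_positive)
  then have "t * q x \<le> q (t *\<^sub>R x)"
    using t by (simp add: field_simps)
  moreover have "q (t *\<^sub>R x) \<le> t * q x"
    using assms(1) t by (simp add: sublinear_def)
  ultimately show ?thesis by linarith
qed

lemma sublinear_lower: "sublinear q \<Longrightarrow> - q (- x) \<le> q x"
  using sublinear_add[of q x "- x"] sublinear_0[of q] by simp

text \<open>A minimal \<open>q\<close> equals the sublinear minorant obtained by sliding along a
  direction \<open>a\<close>; comparison at \<open>t = 1\<close> makes \<open>q\<close>
  superadditive, hence additive and odd.\<close>

lemma sublinear_minimal_imp_linear:
  assumes q: "sublinear q"
    and min: "\<And>r. sublinear r \<Longrightarrow> (\<And>x. r x \<le> q x) \<Longrightarrow> r = q"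
  shows "linear q"
proof -
  have superadd: "q x + q a \<le> q (x + a)" for x a
  proof -
    define r where "r x = (INF t\<in>{0..}. q (x + t *\<^sub>R a) - t * q a)" for x
    have lower: "- q (- x) \<le> q (x + t *\<^sub>R a) - t * q a" if "t \<ge> 0" for x t
      using sublinear_add[OF q, of "x + t *\<^sub>R a" "- x"] sublinear_scale[OF q that, of a] by simp
    then have bdd: "bdd_below ((\<lambda>t. q (x + t *\<^sub>R a) - t * q a) ` {0..})" for x
      by (intro bdd_belowI[where m = "- q (- x)"]) auto
    have r_le: "r x \<le> q (x + t *\<^sub>R a) - t * q a" if "t \<ge> 0" for x t
      unfolding r_def using that by (intro cINF_lower[OF bdd]) auto
    have le_r: "u \<le> r x" if "\<And>t. t \<ge> 0 \<Longrightarrow> u \<le> q (x + t *\<^sub>R a) - t * q a" for u x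
      unfolding r_def using that by (intro cINF_greatest) auto
    have "r (x + y) \<le> r x + r y" for x y
    proof -
      have "r (x + y) - r y \<le> r x"
      proof (rule le_r)
        fix t :: real assume t: "t \<ge> 0"
        have "r (x + y) - (q (x + t *\<^sub>R a) - t * q a) \<le> r y"
        proof (rule le_r)
          fix s :: real assume s: "s \<ge> 0"
          have "r (x + y) \<le> q (x + y + (t + s) *\<^sub>R a) - (t + s) * q a"
            using s t by (intro r_le) simp
          moreover have "q (x + y + (t + s) *\<^sub>R a) \<le> q (x + t *\<^sub>R a) + q (y + s *\<^sub>R a)"
            using sublinear_add[OF q, of "x + t *\<^sub>R a" "y + s *\<^sub>R a"]
            by (simp add: algebra_simps)
          ultimately show "r (x + y) - (q (x + t *\<^sub>R a) - t * q a) \<le> q (y + s *\<^sub>R a) - s * q a"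
            by (simp add: algebra_simps)
        qed
        then show "r (x + y) - r y \<le> q (x + t *\<^sub>R a) - t * q a" by simp
      qed
      then show ?thesis by simp
    qed
    moreover have "r (c *\<^sub>R x) \<le> c * r x" if "c > 0" for c x
    proof -
      have "r (c *\<^sub>R x) / c \<le> r x"
      proof (rule le_r)
        fix t :: real assume t: "t \<ge> 0"
        have "r (c *\<^sub>R x) \<le> q (c *\<^sub>R x + (c * t) *\<^sub>R a) - (c * t) * q a"
          using that t by (intro r_le) simp
        also have "q (c *\<^sub>R x + (c * t) *\<^sub>R a) = c * q (x + t *\<^sub>R a)"
          using sublinear_scale[OF q, of c "x + t *\<^sub>R a"] that by (simp add: scaleR_add_right)
        finally show "r (c *\<^sub>R x) / c \<le> q (x + t *\<^sub>R a) - t * q a"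
          using that by (simp add: field_simps)
      qed
      then show ?thesis using that by (simp add: field_simps)
    qed
    ultimately have "sublinear r" by (simp add: sublinear_def)
    moreover have "r x \<le> q x" for x using r_le[of 0 x] by simp
    ultimately have "r = q" by (rule min)
    then show ?thesis using r_le[of 1 x] by simp
  qed
  have add: "q (x + y) = q x + q y" for x y
    using superadd[of x y] sublinear_add[OF q, of x y] by simp
  have neg: "q (- x) = - q x" for x
    using add[of x "- x"] sublinear_0[OF q] by simp
  have "q (c *\<^sub>R x) = c * q x" for c x
  proof (cases "c \<ge> 0")
    case False
    then show ?thesis using sublinear_scale[OF q, of "- c" "x"] neg[of "c *\<^sub>R x"] by simp
  qed (simp add: sublinear_scale[OF q])
  with add show ?thesis by (intro linearI) auto
qed

lemma sublinear_dominates_linear: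
  fixes p :: "'a::real_vector \<Rightarrow> real"
  assumes p: "sublinear p"
  obtains \<phi> where "linear \<phi>" "\<And>x. \<phi> x \<le> p x"
proof -
  define A where "A = {q. sublinear q \<and> (\<forall>x. q x \<le> p x)}"
  \<comment> \<open>The order is reversed, so the maximal element of Zorn's lemma is a minimal
    functional.\<close>
  define P where "P q r \<longleftrightarrow> (\<forall>x. r x \<le> q x)" for q r :: "'a \<Rightarrow> real"
  have "\<exists>m\<in>A. \<forall>q\<in>A. P m q \<longrightarrow> q = m"
  proof (rule predicate_Zorn)
    show "partial_order_on A (relation_of P A)"
      by (rule partial_order_on_relation_ofI) (auto simp: P_def fun_eq_iff intro: order_trans antisym)
    fix C assume C: "C \<in> Chains (relation_of P A)"
    then have CA: "C \<subseteq> A" and tot: "\<And>q r. q \<in> C \<Longrightarrow> r \<in> C \<Longrightarrow> P q r \<or> P r q"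
      by (auto simp: Chains_def relation_of_def)
    show "\<exists>u\<in>A. \<forall>q\<in>C. P q u"
    proof (cases "C = {}")
      case True
      then show ?thesis using p by (auto simp: A_def)
    next
      case False
      define u where "u x = (INF q\<in>C. q x)" for x
      have "- p (- x) \<le> q x" if "q \<in> C" for q x
      proof -
        have "sublinear q" "q (- x) \<le> p (- x)" using that CA by (auto simp: A_def)
        then show ?thesis using sublinear_lower[of q x] by linarith
      qed
      then have bdd: "bdd_below ((\<lambda>q. q x) ` C)" for x
        by (intro bdd_belowI[where m = "- p (- x)"]) auto
      have u_le: "u x \<le> q x" if "q \<in> C" for q x
        unfolding u_def using that by (intro cINF_lower[OF bdd])
      have le_u: "a \<le> u x" if "\<And>q. q \<in> C \<Longrightarrow> a \<le> q x" for a x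
        unfolding u_def using that False by (intro cINF_greatest) auto
      have "u (x + y) \<le> u x + u y" for x y
      proof -
        have "u (x + y) - u y \<le> u x"
        proof (rule le_u)
          fix q assume q: "q \<in> C"
          have "u (x + y) - q x \<le> u y"
          proof (rule le_u)
            fix r assume r: "r \<in> C"
            \<comment> \<open>The smaller of the two chain members serves both \<open>x\<close> and
              \<open>y\<close>, which makes the infimum subadditive.\<close>
            have "\<exists>s\<in>C. s x \<le> q x \<and> s y \<le> r y"
              using tot[OF q r] q r by (auto simp: P_def)
            then obtain s where s: "s \<in> C" "s x \<le> q x" "s y \<le> r y" by blast
            then have "s (x + y) \<le> s x + s y" using CA by (auto simp: A_def sublinear_add)
            then show "u (x + y) - q x \<le> r y"
              using u_le[OF s(1), of "x + y"] s by linarith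
          qed
          then show "u (x + y) - u y \<le> q x" by simp
        qed
        then show ?thesis by simp
      qed
      moreover have "u (c *\<^sub>R x) \<le> c * u x" if c: "c > 0" for c x
      proof -
        have "u (c *\<^sub>R x) / c \<le> u x"
        proof (rule le_u)
          fix q assume q: "q \<in> C"
          then have "q (c *\<^sub>R x) \<le> c * q x" using CA c by (auto simp: A_def sublinear_def)
          then show "u (c *\<^sub>R x) / c \<le> q x"
            using u_le[OF q, of "c *\<^sub>R x"] c by (simp add: field_simps)
        qed
        then show ?thesis using c by (simp add: field_simps)
      qed
      ultimately have "sublinear u" by (simp add: sublinear_def)
      moreover have "u x \<le> p x" for x
      proof -
        obtain q where "q \<in> C" using False by blast
        then have "u x \<le> q x" "q x \<le> p x" using u_le[of q x] CA by (auto simp: A_def)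
        then show ?thesis by linarith
      qed
      ultimately show ?thesis using u_le by (auto simp: A_def P_def)
    qed
  qed
  then obtain m where m: "m \<in> A" "\<And>q. q \<in> A \<Longrightarrow> P m q \<Longrightarrow> q = m" by blast
  have "linear m"
  proof (rule sublinear_minimal_imp_linear)
    show "sublinear m" using m by (simp add: A_def)
    fix r assume "sublinear r" "\<And>x. r x \<le> m x"
    moreover from this have "r x \<le> p x" for x
      using m(1) order_trans[of "r x" "m x" "p x"] by (simp add: A_def)
    ultimately show "r = m" by (intro m(2)) (simp_all add: A_def P_def)
  qed
  then show thesis using that m(1) by (auto simp: A_def)
qed

text \<open>Plain functions are used so that the set lies in \<open>'a \<Rightarrow> real\<close>,
  whose product topology restricts to the weak-star topology.\<close>

definition dual_ball :: "('a::real_normed_vector \<Rightarrow> real) set" where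
  "dual_ball = {\<phi>. linear \<phi> \<and> (\<forall>x. \<bar>\<phi> x\<bar> \<le> norm x)}"

lemma dual_ball_bounded_linear: "\<phi> \<in> dual_ball \<Longrightarrow> bounded_linear \<phi>"
  unfolding dual_ball_def bounded_linear_def bounded_linear_axioms_def
  by (auto intro!: exI[of _ 1])

lemma dual_ball_uminus: "\<phi> \<in> dual_ball \<Longrightarrow> (\<lambda>x. - \<phi> x) \<in> dual_ball"
  by (auto simp: dual_ball_def intro: linear_compose_neg)

lemma dual_ball_linear: "\<phi> \<in> dual_ball \<Longrightarrow> linear \<phi>"
  by (simp add: dual_ball_def)

lemma dual_ball_zero: "(\<lambda>_. 0) \<in> dual_ball"
  by (simp add: dual_ball_def linear_zero)

text \<open>Allows every weak topological statement to be tested on \<open>dual_ball\<close>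
  alone.\<close>

lemma bounded_linear_multiple_dual_ball:
  fixes \<phi> :: "'a::real_normed_vector \<Rightarrow> real"
  assumes "bounded_linear \<phi>"
  obtains c \<psi> where "c > 0" "\<psi> \<in> dual_ball" "\<phi> = (\<lambda>x. c * \<psi> x)"
proof -
  obtain B where B: "B > 0" "\<And>x. norm (\<phi> x) \<le> norm x * B"
    using bounded_linear.pos_bounded[OF assms] by blast
  define \<psi> where "\<psi> x = \<phi> x / B" for x
  have "linear \<psi>"
    using bounded_linear.linear[OF assms] unfolding \<psi>_def
    by (intro linearI) (auto simp: linear_add linear_scale add_divide_distrib)
  then have "\<psi> \<in> dual_ball" using B by (auto simp: dual_ball_def \<psi>_def field_simps)
  moreover have "\<phi> = (\<lambda>x. B * \<psi> x)" using B by (auto simp: \<psi>_def)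
  ultimately show thesis using that B(1) by blast
qed

text \<open>Extension along the (not necessarily isometric) linear map \<open>f\<close> rather than from a
  subspace: the infimal convolution of \<open>h\<close> and \<open>C * norm\<close> is sublinear.\<close>

lemma hahn_banach_extension:
  fixes f :: "'b::real_vector \<Rightarrow> 'a::real_normed_vector" and h :: "'b \<Rightarrow> real"
  assumes f: "linear f" and h: "linear h" and le: "\<And>z. \<bar>h z\<bar> \<le> C * norm (f z)" and C: "C \<ge> 0"
  obtains \<phi> where "linear \<phi>" "\<And>z. \<phi> (f z) = h z" "\<And>x. \<bar>\<phi> x\<bar> \<le> C * norm x"
proof -
  define p where "p x = (INF z. h z + C * norm (x - f z))" for x
  have lower: "- C * norm x \<le> h z + C * norm (x - f z)" for x z
  proof -
    have "C * norm (f z) \<le> C * (norm x + norm (x - f z))"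
      using C norm_triangle_ineq4[of x "x - f z"] by (intro mult_left_mono) auto
    then show ?thesis using le[of z] by (simp add: algebra_simps)
  qed
  then have bdd: "bdd_below (range (\<lambda>z. h z + C * norm (x - f z)))" for x
    by (intro bdd_belowI[where m = "- C * norm x"]) auto
  have p_le: "p x \<le> h z + C * norm (x - f z)" for x z
    unfolding p_def by (intro cINF_lower[OF bdd]) auto
  have le_p: "a \<le> p x" if "\<And>z. a \<le> h z + C * norm (x - f z)" for a x
    unfolding p_def using that by (intro cINF_greatest) auto
  have "p (x + y) \<le> p x + p y" for x y
  proof -
    have "p (x + y) - p y \<le> p x"
    proof (rule le_p)
      fix z
      have "p (x + y) - (h z + C * norm (x - f z)) \<le> p y"
      proof (rule le_p)
        fix w
        have "p (x + y) \<le> h (z + w) + C * norm (x + y - f (z + w))" by (rule p_le)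
        also have "x + y - f (z + w) = (x - f z) + (y - f w)" using f by (simp add: linear_add)
        also have "C * norm ((x - f z) + (y - f w)) \<le> C * (norm (x - f z) + norm (y - f w))"
          using C by (intro mult_left_mono norm_triangle_ineq)
        finally show "p (x + y) - (h z + C * norm (x - f z)) \<le> h w + C * norm (y - f w)"
          using h by (simp add: linear_add algebra_simps)
      qed
      then show "p (x + y) - p y \<le> h z + C * norm (x - f z)" by simp
    qed
    then show ?thesis by simp
  qed
  moreover have "p (c *\<^sub>R x) \<le> c * p x" if c: "c > 0" for c x
  proof -
    have "p (c *\<^sub>R x) / c \<le> p x"
    proof (rule le_p)
      fix z
      have "p (c *\<^sub>R x) \<le> h (c *\<^sub>R z) + C * norm (c *\<^sub>R x - f (c *\<^sub>R z))" by (rule p_le)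
      also have "c *\<^sub>R x - f (c *\<^sub>R z) = c *\<^sub>R (x - f z)"
        using f by (simp add: linear_scale scaleR_diff_right)
      also have "h (c *\<^sub>R z) + C * norm (c *\<^sub>R (x - f z)) = c * (h z + C * norm (x - f z))"
        using c h by (simp add: linear_scale distrib_left mult.left_commute)
      finally show "p (c *\<^sub>R x) / c \<le> h z + C * norm (x - f z)"
        using c by (simp add: field_simps)
    qed
    then show ?thesis using c by (simp add: field_simps)
  qed
  ultimately have "sublinear p" by (simp add: sublinear_def)
  then obtain \<phi> where \<phi>: "linear \<phi>" "\<And>x. \<phi> x \<le> p x"
    using sublinear_dominates_linear by blast
  \<comment> \<open>The competitor \<open>z\<close> gives domination by \<open>h\<close> on the
    image, and passing to \<open>- z\<close> gives equality; the competitor \<open>0\<close> gives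
    the norm bound.\<close>
  have le1: "\<phi> (f z) \<le> h z" for z using \<phi>(2)[of "f z"] p_le[of "f z" z] by simp
  have "\<phi> (f z) = h z" for z
    using le1[of z] le1[of "- z"] f h \<phi>(1) by (simp add: linear_neg)
  moreover have le2: "\<phi> x \<le> C * norm x" for x
    using \<phi>(2)[of x] p_le[of x 0] f h by (simp add: linear_0)
  have "\<bar>\<phi> x\<bar> \<le> C * norm x" for x
    using le2[of x] le2[of "- x"] \<phi>(1) by (simp add: linear_neg)
  ultimately show thesis using that \<phi>(1) by blast
qed

text \<open>Extends from the line through \<open>x\<close>. The case \<open>x = 0\<close> needs no
  separate treatment, as the map extended along may fail to be injective.\<close>

lemma dual_ball_norming:
  fixes x :: "'a::real_normed_vector"
  obtains \<phi> where "\<phi> \<in> dual_ball" "\<phi> x = norm x"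
proof -
  obtain \<phi> :: "'a \<Rightarrow> real" where \<phi>: "linear \<phi>" "\<And>t. \<phi> (t *\<^sub>R x) = t * norm x" "\<And>y. \<bar>\<phi> y\<bar> \<le> 1 * norm y"
  proof (rule hahn_banach_extension[of "\<lambda>t. t *\<^sub>R x" "\<lambda>t. t * norm x" 1])
    show "linear (\<lambda>t. t *\<^sub>R x)" by (rule linear_scale_left)
    show "linear (\<lambda>t. t * norm x)" by (intro linearI) (auto simp: algebra_simps)
  qed (auto simp: abs_mult)
  then show thesis using that[of \<phi>] \<phi>(2)[of 1] by (simp add: dual_ball_def)
qed

subsection \<open>The weak topology\<close>

definition weak_nbhd :: "'a::real_normed_vector \<Rightarrow> ('a \<Rightarrow> real) set \<Rightarrow> real \<Rightarrow> 'a set" where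
  "weak_nbhd x \<Phi> e = {y. \<forall>\<phi>\<in>\<Phi>. \<bar>\<phi> (y - x)\<bar> < e}"

lemma openin_weak_vimage:
  fixes \<phi> :: "'a::real_normed_vector \<Rightarrow> real"
  assumes "bounded_linear \<phi>" "open U"
  shows "openin weak_topology (\<phi> -` U)"
  unfolding weak_topology_def using assms by (intro topology_generated_by_Basis) blast

lemma openin_weak_nbhd:
  assumes "finite \<Phi>" "\<Phi> \<subseteq> dual_ball"
  shows "openin weak_topology (weak_nbhd x \<Phi> e)"
proof -
  have "openin weak_topology ((\<Inter>\<phi>\<in>\<Phi>. \<phi> -` {\<phi> x - e<..<\<phi> x + e}) \<inter> UNIV)"
    using assms
  proof (induction \<Phi>)
    case empty
    then show ?case using openin_topspace[of weak_topology] by simp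
  next
    case (insert \<phi> \<Phi>)
    then show ?case
      by (auto simp: Int_assoc intro!: openin_Int openin_weak_vimage dual_ball_bounded_linear)
  qed
  also have "(\<Inter>\<phi>\<in>\<Phi>. \<phi> -` {\<phi> x - e<..<\<phi> x + e}) \<inter> UNIV = weak_nbhd x \<Phi> e"
    using assms by (auto simp: weak_nbhd_def linear_diff[OF dual_ball_linear] abs_less_iff subset_iff)
  finally show ?thesis .
qed

text \<open>Induction over the generation of the open set; subbasic sets are handled by rescaling
  one functional into \<open>dual_ball\<close>.\<close>

lemma openin_weak_imp_nbhd:
  fixes x :: "'a::real_normed_vector"
  assumes "openin weak_topology U" "x \<in> U"
  obtains \<Phi> e where "finite \<Phi>" "\<Phi> \<subseteq> dual_ball" "e > 0" "weak_nbhd x \<Phi> e \<subseteq> U"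
proof -
  have "generate_topology_on {f -` U | (f :: 'a \<Rightarrow> real) U. bounded_linear f \<and> open U} U"
    using assms(1) by (simp add: weak_topology_def openin_topology_generated_by_iff)
  then have "\<exists>\<Phi> e. finite \<Phi> \<and> \<Phi> \<subseteq> dual_ball \<and> e > 0 \<and> weak_nbhd x \<Phi> e \<subseteq> U"
    using assms(2)
  proof induction
    case Empty
    then show ?case by simp
  next
    case (Int a b)
    then obtain \<Phi> e \<Psi> d where "finite \<Phi> \<and> \<Phi> \<subseteq> dual_ball \<and> e > 0 \<and> weak_nbhd x \<Phi> e \<subseteq> a"
      "finite \<Psi> \<and> \<Psi> \<subseteq> dual_ball \<and> d > 0 \<and> weak_nbhd x \<Psi> d \<subseteq> b" by auto
    moreover have "weak_nbhd x (\<Phi> \<union> \<Psi>) (min e d) \<subseteq> weak_nbhd x \<Phi> e \<inter> weak_nbhd x \<Psi> d"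
      by (auto simp: weak_nbhd_def)
    ultimately show ?case
      by (intro exI[of _ "\<Phi> \<union> \<Psi>"] exI[of _ "min e d"]) auto
  next
    case (UN K)
    then obtain k where "k \<in> K" "x \<in> k" by blast
    with UN.IH[of k] show ?case by blast
  next
    case (Basis s)
    then obtain f :: "'a \<Rightarrow> real" and V where fV: "s = f -` V" "bounded_linear f" "open V" by blast
    then have "f x \<in> V" using Basis.prems by simp
    then obtain e where e: "e > 0" "ball (f x) e \<subseteq> V"
      using openE[OF fV(3)] by blast
    obtain c \<psi> where c: "c > 0" "\<psi> \<in> dual_ball" "f = (\<lambda>x. c * \<psi> x)"
      using bounded_linear_multiple_dual_ball[OF fV(2)] .
    have "weak_nbhd x {\<psi>} (e / c) \<subseteq> s"
    proof
      fix y assume "y \<in> weak_nbhd x {\<psi>} (e / c)"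
      then have "c * \<bar>\<psi> y - \<psi> x\<bar> < e"
        using c(1) linear_diff[OF dual_ball_linear[OF c(2)]] by (simp add: weak_nbhd_def field_simps)
      also have "c * \<bar>\<psi> y - \<psi> x\<bar> = dist (f x) (f y)"
        using c(1) by (simp add: c(3) dist_real_def abs_minus_commute abs_mult flip: right_diff_distrib)
      finally show "y \<in> s" using e(2) fV(1) by auto
    qed
    then show ?case using c e by (intro exI[of _ "{\<psi>}"] exI[of _ "e / c"]) auto
  qed
  then show thesis using that by blast
qed

lemma limitin_weak_iff:
  fixes x :: "'a::real_normed_vector"
  shows
  "limitin weak_topology s x sequentially \<longleftrightarrow> (\<forall>\<phi>\<in>dual_ball. (\<lambda>n. \<phi> (s n - x)) \<longlonglongrightarrow> 0)"
proof (intro iffI ballI)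
  fix \<phi> :: "'a \<Rightarrow> real"
  assume lim: "limitin weak_topology s x sequentially" and \<phi>: "\<phi> \<in> dual_ball"
  show "(\<lambda>n. \<phi> (s n - x)) \<longlonglongrightarrow> 0"
  proof (rule tendstoI)
    fix e :: real assume "e > 0"
    then have "\<forall>\<^sub>F n in sequentially. s n \<in> weak_nbhd x {\<phi>} e"
      using \<phi> by (intro limitinD[OF lim] openin_weak_nbhd)
        (auto simp: weak_nbhd_def linear_0[OF dual_ball_linear])
    then show "\<forall>\<^sub>F n in sequentially. dist (\<phi> (s n - x)) 0 < e"
      by (simp add: weak_nbhd_def)
  qed
next
  assume *: "\<forall>\<phi>\<in>dual_ball. (\<lambda>n. \<phi> (s n - x)) \<longlonglongrightarrow> 0"
  show "limitin weak_topology s x sequentially"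
    unfolding limitin_def
  proof (intro conjI allI impI)
    fix U assume "openin weak_topology U \<and> x \<in> U"
    then obtain \<Phi> e where \<Phi>: "finite \<Phi>" "\<Phi> \<subseteq> dual_ball" "e > 0" "weak_nbhd x \<Phi> e \<subseteq> U"
      using openin_weak_imp_nbhd by blast
    have "\<forall>\<^sub>F n in sequentially. \<forall>\<phi>\<in>\<Phi>. \<bar>\<phi> (s n - x)\<bar> < e"
    proof (rule eventually_ball_finite[OF \<Phi>(1)], rule ballI)
      fix \<phi> assume "\<phi> \<in> \<Phi>"
      then have "(\<lambda>n. \<phi> (s n - x)) \<longlonglongrightarrow> 0" using * \<Phi>(2) by blast
      from tendstoD[OF this \<Phi>(3)] show "\<forall>\<^sub>F n in sequentially. \<bar>\<phi> (s n - x)\<bar> < e" by simp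
    qed
    then show "\<forall>\<^sub>F n in sequentially. s n \<in> U"
      by eventually_elim (use \<Phi>(4) in \<open>auto simp: weak_nbhd_def\<close>)
  qed simp
qed

text \<open>Functionals in \<open>dual_ball\<close> are 1-Lipschitz, so norm balls fit into weak
  neighbourhoods. This makes Baire's theorem applicable to a weakly closed cover.\<close>

lemma weakly_closed_imp_closed:
  fixes S :: "'a::real_normed_vector set"
  assumes "closedin weak_topology S"
  shows "closed S"
proof -
  have "open (- S)"
  proof (rule openI)
    fix x assume "x \<in> - S"
    moreover have "openin weak_topology (- S)"
      using assms by (simp add: closedin_def Compl_eq_Diff_UNIV)
    ultimately obtain \<Phi> e where \<Phi>: "finite \<Phi>" "\<Phi> \<subseteq> dual_ball" "e > 0" "weak_nbhd x \<Phi> e \<subseteq> - S"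
      using openin_weak_imp_nbhd by blast
    have "ball x e \<subseteq> weak_nbhd x \<Phi> e"
    proof
      fix y assume "y \<in> ball x e"
      then have "\<bar>\<phi> (y - x)\<bar> < e" if "\<phi> \<in> dual_ball" for \<phi>
        using that by (auto simp: dual_ball_def dist_norm norm_minus_commute intro: le_less_trans)
      then show "y \<in> weak_nbhd x \<Phi> e" using \<Phi>(2) by (auto simp: weak_nbhd_def)
    qed
    then show "\<exists>e>0. ball x e \<subseteq> - S" using \<Phi> by blast
  qed
  then show ?thesis by (simp add: closed_def)
qed

text \<open>By norming functionals the ball is an intersection of half-spaces.\<close>

lemma weakly_closed_cball: "closedin weak_topology (cball (0::'a::real_normed_vector) r)"
proof -
  have "cball (0::'a) r = (\<Inter>\<phi>\<in>dual_ball. \<phi> -` {..r})"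
  proof (intro equalityI subsetI)
    fix x :: 'a assume "x \<in> cball 0 r"
    then show "x \<in> (\<Inter>\<phi>\<in>dual_ball. \<phi> -` {..r})" by (auto simp: dual_ball_def intro: order_trans abs_le_D1)
  next
    fix x :: 'a assume "x \<in> (\<Inter>\<phi>\<in>dual_ball. \<phi> -` {..r})"
    moreover obtain \<phi> where "\<phi> \<in> dual_ball" "\<phi> x = norm x" by (rule dual_ball_norming)
    ultimately show "x \<in> cball 0 r" by force
  qed
  moreover have "closedin weak_topology (\<phi> -` {..r})" if "\<phi> \<in> dual_ball" for \<phi> :: "'a \<Rightarrow> real"
  proof -
    have "openin weak_topology (\<phi> -` {r<..})"
      using that by (intro openin_weak_vimage dual_ball_bounded_linear) auto
    moreover have "\<phi> -` {r<..} = UNIV - \<phi> -` {..r}" by auto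
    ultimately show ?thesis by (simp add: closedin_def)
  qed
  ultimately show ?thesis
    using dual_ball_zero by (metis (no_types, lifting) closedin_INT empty_iff)
qed

text \<open>A closure point relative to \<open>T\<close> lies in \<open>T\<close> and in the closure
  relative to \<open>S\<close>, so the sequence supplied by \<open>S\<close> converges within
  \<open>T\<close>.\<close>

lemma frechet_urysohn_subtopology:
  assumes "frechet_urysohn_space (subtopology X S)" "T \<subseteq> S"
  shows "frechet_urysohn_space (subtopology X T)"
  unfolding frechet_urysohn_space_def
proof (intro allI impI)
  fix A x assume *: "A \<subseteq> topspace (subtopology X T) \<and> x \<in> subtopology X T closure_of A"
  then have "A \<subseteq> topspace (subtopology X S)" "x \<in> subtopology X S closure_of A"
    using assms(2) unfolding in_closure_of openin_subtopology topspace_subtopology by blast+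
  then obtain s where s: "range s \<subseteq> A" "limitin (subtopology X S) s x sequentially"
    using assms(1) unfolding frechet_urysohn_space_def by blast
  moreover have "limitin (subtopology X T) s x sequentially"
    using s * by (auto simp: limitin_subtopology in_closure_of image_subset_iff subset_iff)
  ultimately show "\<exists>s. range s \<subseteq> A \<and> limitin (subtopology X T) s x sequentially" by blast
qed

subsection \<open>Sets clustering weakly at the origin\<close>

text \<open>Banach-Alaoglu: Tychonoff gives a compact product of intervals, and linearity is closed
  because it consists of equations between coordinates.\<close>

lemma compact_dual_ball: "compact (dual_ball :: ('a::real_normed_vector \<Rightarrow> real) set)"
proof -
  let ?P = "\<Pi>\<^sub>E x\<in>UNIV. {- norm x..norm (x::'a)}"
  have "compactin (product_topology (\<lambda>_. euclidean) UNIV) ?P"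
    by (simp add: compactin_PiE)
  then have cP: "compact ?P" by (simp add: euclidean_product_topology)
  have "closed {\<phi>. (\<forall>x y::'a. \<phi> (x + y) = \<phi> x + (\<phi> y::real)) \<and> (\<forall>c x. \<phi> (c *\<^sub>R x) = c * \<phi> x)}"
    by (intro closed_Collect_conj closed_Collect_all closed_Collect_eq continuous_intros
        continuous_on_product_coordinates)
  also have "{\<phi>. (\<forall>x y::'a. \<phi> (x + y) = \<phi> x + (\<phi> y::real)) \<and> (\<forall>c x. \<phi> (c *\<^sub>R x) = c * \<phi> x)} = {\<phi>. linear \<phi>}"
    by (auto simp: linear_iff)
  finally have "compact (?P \<inter> {\<phi>. linear \<phi>})" using cP by (rule compact_Int_closed[rotated])
  also have "?P \<inter> {\<phi>. linear \<phi>} = dual_ball"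
    by (auto simp: dual_ball_def PiE_iff abs_le_iff minus_le_iff)
  finally show ?thesis .
qed

definition clusters_weakly_at_0 :: "'a::real_normed_vector set \<Rightarrow> bool" where
  "clusters_weakly_at_0 M \<longleftrightarrow>
     (\<forall>\<Phi> e. finite \<Phi> \<and> \<Phi> \<subseteq> dual_ball \<and> 0 < e \<longrightarrow> (\<exists>x\<in>M. \<forall>\<phi>\<in>\<Phi>. \<bar>\<phi> x\<bar> < e))"

lemma clusters_weakly_at_0D:
  assumes "clusters_weakly_at_0 M" "finite \<Phi>" "\<Phi> \<subseteq> dual_ball" "0 < e"
  obtains x where "x \<in> M" "\<And>\<phi>. \<phi> \<in> \<Phi> \<Longrightarrow> \<bar>\<phi> x\<bar> < e"
  using assms unfolding clusters_weakly_at_0_def by meson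

lemma not_clusters_weakly_at_0E:
  assumes "\<not> clusters_weakly_at_0 M"
  obtains \<Phi> e where "finite \<Phi>" "\<Phi> \<subseteq> dual_ball" "0 < e" "\<And>x. x \<in> M \<Longrightarrow> \<exists>\<phi>\<in>\<Phi>. e \<le> \<bar>\<phi> x\<bar>"
proof -
  obtain \<Phi> e where *: "finite \<Phi> \<and> \<Phi> \<subseteq> dual_ball \<and> 0 < e" "\<not> (\<exists>x\<in>M. \<forall>\<phi>\<in>\<Phi>. \<bar>\<phi> x\<bar> < e)"
    using assms unfolding clusters_weakly_at_0_def by auto
  then show thesis by (intro that[of \<Phi> e]) (auto simp: not_less)
qed

lemma clusters_weakly_at_0_mono:
  "clusters_weakly_at_0 M \<Longrightarrow> M \<subseteq> N \<Longrightarrow> clusters_weakly_at_0 N"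
  unfolding clusters_weakly_at_0_def by (meson subsetD)

lemma not_clusters_weakly_at_0_empty [simp]: "\<not> clusters_weakly_at_0 {}"
  unfolding clusters_weakly_at_0_def by (auto intro!: exI[of _ 1])

text \<open>Merging the witnesses of both sets shows that nonclustering sets form an ideal, so
  finitely many of them cannot exhaust a clustering set.\<close>

lemma clusters_weakly_at_0_Un:
  assumes "clusters_weakly_at_0 (M \<union> N)"
  shows "clusters_weakly_at_0 M \<or> clusters_weakly_at_0 N"
proof (rule ccontr)
  assume "\<not> ?thesis"
  then have MN: "\<not> clusters_weakly_at_0 M" "\<not> clusters_weakly_at_0 N" by auto
  obtain \<Phi> d where
    \<Phi>: "finite \<Phi>" "\<Phi> \<subseteq> dual_ball" "0 < d" "\<And>x. x \<in> M \<Longrightarrow> \<exists>\<phi>\<in>\<Phi>. d \<le> \<bar>\<phi> x\<bar>"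
    using not_clusters_weakly_at_0E[OF MN(1)] by metis
  obtain \<Psi> e where
    \<Psi>: "finite \<Psi>" "\<Psi> \<subseteq> dual_ball" "0 < e" "\<And>x. x \<in> N \<Longrightarrow> \<exists>\<phi>\<in>\<Psi>. e \<le> \<bar>\<phi> x\<bar>"
    using not_clusters_weakly_at_0E[OF MN(2)] by metis
  have "finite (\<Phi> \<union> \<Psi>)" "\<Phi> \<union> \<Psi> \<subseteq> dual_ball" "0 < min d e" using \<Phi>(1-3) \<Psi>(1-3) by auto
  then obtain x where "x \<in> M \<union> N" "\<And>\<phi>. \<phi> \<in> \<Phi> \<union> \<Psi> \<Longrightarrow> \<bar>\<phi> x\<bar> < min d e"
    by (rule clusters_weakly_at_0D[OF assms]) blast
  then show False using \<Phi>(4)[of x] \<Psi>(4)[of x] by fastforce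
qed

lemma clusters_weakly_at_0_UN:
  assumes "finite I" "clusters_weakly_at_0 (\<Union>i\<in>I. M i)"
  shows "\<exists>i\<in>I. clusters_weakly_at_0 (M i)"
  using assms by (induction I) (auto dest: clusters_weakly_at_0_Un)

text \<open>Clustering would pass to a single point of \<open>F\<close>, where one functional
  refutes it. Hence finite sets may be discarded from clustering sets.\<close>

lemma finite_not_clusters_weakly_at_0:
  assumes "finite F" "\<And>y. y \<in> F \<Longrightarrow> \<exists>\<phi>\<in>dual_ball. \<phi> y \<noteq> 0"
  shows "\<not> clusters_weakly_at_0 F"
proof
  assume "clusters_weakly_at_0 F"
  then have "clusters_weakly_at_0 (\<Union>y\<in>F. {y})" by simp
  then obtain y where y: "y \<in> F" "clusters_weakly_at_0 {y}"
    using clusters_weakly_at_0_UN[OF assms(1)] by blast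
  then obtain \<phi> where \<phi>: "\<phi> \<in> dual_ball" "\<phi> y \<noteq> 0" using assms(2) by blast
  show False
    by (rule clusters_weakly_at_0D[OF y(2), of "{\<phi>}" "\<bar>\<phi> y\<bar>"]) (use \<phi> in auto)
qed

text \<open>Compactness of the countable power of the dual ball gives countable fan tightness.\<close>

lemma clusters_weakly_at_0_finite_block:
  fixes M :: "'a::real_normed_vector set" and n :: nat
  assumes M: "clusters_weakly_at_0 M" and "0 < e"
  obtains B where "finite B" "B \<subseteq> M"
    "\<And>\<psi>. (\<And>i. \<psi> i \<in> dual_ball) \<Longrightarrow> \<exists>x\<in>B. \<forall>i<n. \<bar>\<psi> i x\<bar> < e"
proof -
  let ?P = "\<Pi>\<^sub>E i\<in>(UNIV::nat set). (dual_ball :: ('a \<Rightarrow> real) set)"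
  define U :: "'a \<Rightarrow> (nat \<Rightarrow> 'a \<Rightarrow> real) set" where "U x = {\<psi>. \<forall>i\<in>{..<n}. \<bar>\<psi> i x\<bar> < e}" for x
  have "compactin (product_topology (\<lambda>_. euclidean) UNIV) ?P"
    by (simp add: compactin_PiE compact_dual_ball)
  then have "compact ?P" by (simp add: euclidean_product_topology)
  moreover have "open (U x)" for x
  proof -
    have "continuous_on UNIV (\<lambda>\<psi> :: nat \<Rightarrow> 'a \<Rightarrow> real. \<psi> i x)" for i
      by (rule continuous_on_product_then_coordinatewise[OF continuous_on_product_coordinates])
    then have "open {\<psi> :: nat \<Rightarrow> 'a \<Rightarrow> real. \<bar>\<psi> i x\<bar> < e}" for i
      by (intro open_Collect_less continuous_intros)
    moreover have "U x = (\<Inter>i\<in>{..<n}. {\<psi>. \<bar>\<psi> i x\<bar> < e})" by (auto simp: U_def)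
    ultimately show ?thesis by (auto intro: open_INT)
  qed
  moreover have "?P \<subseteq> (\<Union>x\<in>M. U x)"
  proof
    fix \<psi> assume "\<psi> \<in> ?P"
    then have "finite (\<psi> ` {..<n})" "\<psi> ` {..<n} \<subseteq> dual_ball" by (auto simp: PiE_iff)
    then obtain x where "x \<in> M" "\<And>\<phi>. \<phi> \<in> \<psi> ` {..<n} \<Longrightarrow> \<bar>\<phi> x\<bar> < e"
      using clusters_weakly_at_0D[OF M _ _ assms(2)] by metis
    then show "\<psi> \<in> (\<Union>x\<in>M. U x)" by (auto simp: U_def)
  qed
  ultimately obtain B where "B \<subseteq> M" "finite B" "?P \<subseteq> (\<Union>x\<in>B. U x)"
    by (rule compactE_image)
  then show thesis
    by (intro that[of B]) (simp_all add: U_def PiE_iff subset_iff lessThan_iff Ball_def)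
qed

text \<open>\<open>L\<close> is the union of finite blocks \<open>B n\<close> inside
  \<open>M n\<close>, where \<open>B n\<close> handles all \<open>n\<close>-tuples of functionals
  with tolerance \<open>1 / Suc n\<close>. Since \<open>M\<close> decreases, only the first
  \<open>n\<close> blocks can leave \<open>M n\<close>.\<close>

lemma clusters_weakly_at_0_pseudo_intersection:
  fixes M :: "nat \<Rightarrow> 'a::real_normed_vector set"
  assumes M: "\<And>n. clusters_weakly_at_0 (M n)" and dec: "decseq M"
  obtains L where "clusters_weakly_at_0 L" "L \<subseteq> M 0" "countable L" "\<And>n. finite (L - M n)"
proof -
  have "\<exists>B. finite B \<and> B \<subseteq> M n \<and>
      (\<forall>\<psi>. (\<forall>i. \<psi> i \<in> dual_ball) \<longrightarrow> (\<exists>x\<in>B. \<forall>i<n. \<bar>\<psi> i x\<bar> < 1 / Suc n))" for n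
    by (rule clusters_weakly_at_0_finite_block[OF M, of "1 / Suc n" n n]) auto
  then obtain B where B: "\<And>n. finite (B n)" "\<And>n. B n \<subseteq> M n"
      "\<And>n \<psi>. (\<And>i. \<psi> i \<in> dual_ball) \<Longrightarrow> \<exists>x\<in>B n. \<forall>i<n. \<bar>\<psi> i x\<bar> < 1 / Suc n"
    by metis
  define L where "L = (\<Union>n. B n)"
  have "clusters_weakly_at_0 L"
    unfolding clusters_weakly_at_0_def
  proof (intro allI impI)
    fix \<Phi> :: "('a \<Rightarrow> real) set" and e :: real
    assume *: "finite \<Phi> \<and> \<Phi> \<subseteq> dual_ball \<and> 0 < e"
    then obtain N \<psi> where \<psi>: "\<Phi> = \<psi> ` {i::nat. i < N}"
      using finite_imp_nat_seg_image_inj_on by metis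
    obtain k where k: "1 / Suc k < e" using * nat_approx_posE by blast
    define n where "n = max N k"
    have "1 / Suc n \<le> 1 / Suc k" by (simp add: n_def frac_le)
    \<comment> \<open>Padding with the zero functional turns the finite list into a sequence in
      \<open>dual_ball\<close>.\<close>
    define \<eta> where "\<eta> i = (if i < N then \<psi> i else (\<lambda>_. 0))" for i
    have "\<eta> i \<in> dual_ball" for i
      using * \<psi> by (auto simp: \<eta>_def dual_ball_zero)
    then obtain x where x: "x \<in> B n" "\<forall>i<n. \<bar>\<eta> i x\<bar> < 1 / Suc n" using B(3) by blast
    have "\<bar>\<phi> x\<bar> < e" if "\<phi> \<in> \<Phi>" for \<phi>
    proof -
      obtain i where "i < N" "\<phi> = \<eta> i" using \<open>\<phi> \<in> \<Phi>\<close> \<psi> by (auto simp: \<eta>_def)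
      then have "\<bar>\<phi> x\<bar> < 1 / Suc n" using x(2) by (simp add: n_def)
      then show ?thesis using \<open>1 / Suc n \<le> 1 / Suc k\<close> k by linarith
    qed
    then show "\<exists>x\<in>L. \<forall>\<phi>\<in>\<Phi>. \<bar>\<phi> x\<bar> < e" using x(1) by (auto simp: L_def)
  qed
  moreover have "L \<subseteq> M 0"
    using B(2) decseqD[OF dec, of 0] by (fastforce simp: L_def)
  moreover have "countable L" unfolding L_def using B(1) by (simp add: countable_finite)
  moreover have "finite (L - M n)" for n
  proof (rule finite_subset)
    have "x \<in> M n" if "x \<in> B k" "n \<le> k" for x k
      using that B(2) decseqD[OF dec, of n k] by blast
    then show "L - M n \<subseteq> (\<Union>k<n. B k)"
      by (force simp: L_def not_less[symmetric])
  qed (simp add: B(1))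
  ultimately show thesis by (rule that)
qed

subsection \<open>Independent sequences\<close>

text \<open>The bound is one-sided; as \<open>dual_ball\<close> is symmetric, using it for a
  functional and its negative later gives both sides.\<close>

definition almost_below :: "real \<Rightarrow> 'a set \<Rightarrow> ('a \<Rightarrow> real) set \<Rightarrow> bool" where
  "almost_below e M C \<longleftrightarrow> (\<forall>\<phi>\<in>C. finite {x \<in> M. e \<le> \<phi> x})"

text \<open>Serves for subsets of \<open>M\<close> as well as for diagonal sets almost contained in
  it.\<close>

lemma almost_below_finite_Diff:
  assumes "almost_below e M C" "finite (L - M)"
  shows "almost_below e L C"
  unfolding almost_below_def
proof
  fix \<phi> assume "\<phi> \<in> C"
  then have "finite ({x \<in> M. e \<le> \<phi> x} \<union> (L - M))" using assms by (simp add: almost_below_def)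
  then show "finite {x \<in> L. e \<le> \<phi> x}" by (rule rev_finite_subset) auto
qed

definition dual_region :: "real \<Rightarrow> real \<Rightarrow> 'a::real_normed_vector set \<Rightarrow> 'a set \<Rightarrow> ('a \<Rightarrow> real) set" where
  "dual_region a b T S = {\<phi> \<in> dual_ball. (\<forall>x\<in>T. b \<le> \<phi> x) \<and> (\<forall>x\<in>S. \<phi> x \<le> a)}"

text \<open>Shrinking \<open>M\<close> countably often and diagonalising makes \<open>L\<close> decide every region: it is
  either almost below \<open>b\<close> on it, or no clustering subset of \<open>L\<close> is.\<close>

lemma clusters_weakly_at_0_deciding:
  fixes M :: "'a::real_normed_vector set"
  assumes M: "clusters_weakly_at_0 M"
    and nz: "\<forall>y\<in>M. \<exists>\<phi>\<in>dual_ball. \<phi> y \<noteq> 0"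
  obtains L where "L \<subseteq> M" "clusters_weakly_at_0 L"
    "\<forall>T S N. finite T \<and> T \<subseteq> L \<and> finite S \<and> S \<subseteq> L \<and> \<not> almost_below b L (dual_region a b T S) \<and>
       N \<subseteq> L \<and> clusters_weakly_at_0 N \<longrightarrow> \<not> almost_below b N (dual_region a b T S)"
proof -
  \<comment> \<open>A constant sequence yields a countable clustering subset, so only countably many
    pairs of finite sets remain to be decided.\<close>
  obtain M0 where M0: "clusters_weakly_at_0 M0" "M0 \<subseteq> M" "countable M0"
    using M by (rule clusters_weakly_at_0_pseudo_intersection[of "\<lambda>_. M"]) (simp_all add: decseq_def)
  define Q where "Q = {T. finite T \<and> T \<subseteq> M0} \<times> {S. finite S \<and> S \<subseteq> M0}"
  have "countable Q" "Q \<noteq> {}"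
    using M0(3) by (auto simp: Q_def countable_Collect_finite_subset)
  define C where "C n = (case from_nat_into Q n of (T, S) \<Rightarrow> dual_region a b T S)" for n
  have C: "\<exists>n. dual_region a b T S = C n" if "finite T" "T \<subseteq> M0" "finite S" "S \<subseteq> M0" for T S
  proof -
    have "(T, S) \<in> Q" using that by (simp add: Q_def)
    then obtain n where "from_nat_into Q n = (T, S)"
      using from_nat_into_surj[OF \<open>countable Q\<close>] by blast
    then show ?thesis by (intro exI[of _ n]) (simp add: C_def)
  qed
  define dec where "dec n N \<longleftrightarrow> almost_below b N (C n) \<or>
    (\<forall>N'\<subseteq>N. clusters_weakly_at_0 N' \<longrightarrow> \<not> almost_below b N' (C n))" for n N
  have "\<exists>f. \<forall>n. (clusters_weakly_at_0 (f n) \<and> f n \<subseteq> M0) \<and> (f (Suc n) \<subseteq> f n \<and> dec n (f (Suc n)))"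
  proof (rule dependent_nat_choice)
    show "\<exists>N. clusters_weakly_at_0 N \<and> N \<subseteq> M0" using M0(1) by blast
    fix N n assume N: "clusters_weakly_at_0 N \<and> N \<subseteq> M0"
    show "\<exists>N'. (clusters_weakly_at_0 N' \<and> N' \<subseteq> M0) \<and> (N' \<subseteq> N \<and> dec n N')"
    proof (cases "dec n N")
      \<comment> \<open>If \<open>N\<close> is undecided, some clustering subset is almost below
        \<open>b\<close> on \<open>C n\<close>; passing to it decides the region.\<close>
      case False
      then show ?thesis using N unfolding dec_def by blast
    qed (use N in blast)
  qed
  then obtain f where f: "\<And>n. clusters_weakly_at_0 (f n)" "\<And>n. f n \<subseteq> M0"
      "\<And>n. f (Suc n) \<subseteq> f n" "\<And>n. dec n (f (Suc n))" by blast
  then obtain L where L: "clusters_weakly_at_0 L" "L \<subseteq> f 0" "\<And>n. finite (L - f n)"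
    using clusters_weakly_at_0_pseudo_intersection[of f] by (metis decseq_SucI)
  have LM: "L \<subseteq> M0" using L(2) f(2) by blast
  show thesis
  proof (rule that; (intro allI impI; elim conjE)?)
    show "L \<subseteq> M" using LM M0(2) by blast
    show "clusters_weakly_at_0 L" by (rule L(1))
    fix T S N
    assume *: "finite T" "T \<subseteq> L" "finite S" "S \<subseteq> L" "\<not> almost_below b L (dual_region a b T S)"
       "N \<subseteq> L" "clusters_weakly_at_0 N"
    obtain n where n: "dual_region a b T S = C n" using C[of T S] * LM by blast
    \<comment> \<open>\<open>L\<close> lies in \<open>f (Suc n)\<close> up to finitely many points,
      so failure on \<open>L\<close> transfers to the decided set.\<close>
    have "\<not> almost_below b (f (Suc n)) (C n)"
      using *(5) n almost_below_finite_Diff[OF _ L(3)] by auto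
    then have largeC: "\<And>N'. N' \<subseteq> f (Suc n) \<Longrightarrow> clusters_weakly_at_0 N' \<Longrightarrow> \<not> almost_below b N' (C n)"
      using f(4)[of n] unfolding dec_def by blast
    \<comment> \<open>Removing finitely many points from \<open>N\<close> leaves a clustering subset
      of \<open>f (Suc n)\<close>, to which the decision applies.\<close>
    have "N = (N \<inter> f (Suc n)) \<union> (N - f (Suc n))" by blast
    moreover have "finite (N - f (Suc n))"
      using L(3)[of "Suc n"] *(6) by (meson Diff_mono finite_subset order_refl)
    then have "\<not> clusters_weakly_at_0 (N - f (Suc n))"
      using *(6) LM M0(2) nz
      by (intro finite_not_clusters_weakly_at_0) (auto simp: subset_iff)
    ultimately have "clusters_weakly_at_0 (N \<inter> f (Suc n))"
      using *(7) clusters_weakly_at_0_Un by metis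
    then have "\<not> almost_below b (N \<inter> f (Suc n)) (C n)" by (intro largeC) auto
    moreover have "almost_below b (N \<inter> f (Suc n)) (C n)" if "almost_below b N (C n)"
      using that by (rule almost_below_finite_Diff) (simp add: Diff_eq Int_assoc)
    ultimately show "\<not> almost_below b N (dual_region a b T S)" unfolding n by blast
  qed
qed

text \<open>While all patterns on the chosen points stay large, the forbidden next points form a
  nonclustering set; \<open>L\<close> clusters, so the construction never stops.\<close>

lemma independent_sequence:
  fixes M :: "'a::real_normed_vector set"
  assumes M: "clusters_weakly_at_0 M"
    and nz: "\<forall>y\<in>M. \<exists>\<phi>\<in>dual_ball. \<phi> y \<noteq> 0"
    and none: "\<forall>N\<subseteq>M. clusters_weakly_at_0 N \<longrightarrow> \<not> almost_below b N dual_ball"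
    and a: "0 < a"
  obtains x :: "nat \<Rightarrow> 'a" where "range x \<subseteq> M"
    "\<forall>n. \<forall>I\<subseteq>{..<n}. \<exists>\<phi>\<in>dual_ball. \<forall>i<n. if i \<in> I then b \<le> \<phi> (x i) else \<phi> (x i) \<le> a"
proof -
  obtain L where L: "L \<subseteq> M" "clusters_weakly_at_0 L" and
    decide: "\<forall>T S N. finite T \<and> T \<subseteq> L \<and> finite S \<and> S \<subseteq> L \<and> \<not> almost_below b L (dual_region a b T S) \<and>
       N \<subseteq> L \<and> clusters_weakly_at_0 N \<longrightarrow> \<not> almost_below b N (dual_region a b T S)"
    by (rule clusters_weakly_at_0_deciding[OF M nz])
  define large where "large T S \<longleftrightarrow> \<not> almost_below b L (dual_region a b T S)" for T S
  \<comment> \<open>A functional with infinitely many exceptions in \<open>?N\<close> is at least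
    \<open>b\<close> at some \<open>x\<close> in \<open>?N\<close>, so it lies in the region refined
    at \<open>x\<close>. Its exceptions in \<open>L\<close> are still infinite, making that region
    large.\<close>
  have upper: "\<not> clusters_weakly_at_0 {x \<in> L. \<not> large (insert x T) S}" (is "\<not> clusters_weakly_at_0 ?N")
    if TS: "finite T" "T \<subseteq> L" "finite S" "S \<subseteq> L" "large T S" for T S
  proof
    assume "clusters_weakly_at_0 ?N"
    moreover have "?N \<subseteq> L" by blast
    ultimately have "\<not> almost_below b ?N (dual_region a b T S)"
      using decide TS unfolding large_def by blast
    then obtain \<phi> where \<phi>: "\<phi> \<in> dual_region a b T S" "infinite {x \<in> ?N. b \<le> \<phi> x}"
      unfolding almost_below_def by blast
    then obtain x where x: "x \<in> ?N" "b \<le> \<phi> x"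
      using not_finite_existsD by blast
    then have "\<phi> \<in> dual_region a b (insert x T) S" using \<phi>(1) by (simp add: dual_region_def)
    then have "finite {x \<in> L. b \<le> \<phi> x}" using x(1) by (auto simp: large_def almost_below_def)
    then have "finite {x \<in> ?N. b \<le> \<phi> x}" by (rule rev_finite_subset) auto
    then show False using \<phi>(2) by blast
  qed
  \<comment> \<open>Here the functional is chosen first, and clustering supplies an \<open>x\<close>
    where it is below \<open>a\<close>; it then witnesses largeness of the refined region.\<close>
  have lower: "\<not> clusters_weakly_at_0 {x \<in> L. \<not> large T (insert x S)}" (is "\<not> clusters_weakly_at_0 ?N")
    if TS: "large T S" for T S
  proof
    assume N: "clusters_weakly_at_0 ?N"
    obtain \<phi> where \<phi>: "\<phi> \<in> dual_region a b T S" "infinite {x \<in> L. b \<le> \<phi> x}"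
      using TS unfolding large_def almost_below_def by blast
    obtain x where x: "x \<in> ?N" "\<bar>\<phi> x\<bar> < a"
      using \<phi>(1) a by (auto simp: dual_region_def intro: clusters_weakly_at_0D[OF N, of "{\<phi>}" a])
    then have "\<phi> \<in> dual_region a b T (insert x S)" using \<phi>(1) by (simp add: dual_region_def)
    then show False using x(1) \<phi>(2) by (auto simp: large_def almost_below_def)
  qed
  define indep where "indep S \<longleftrightarrow> finite S \<and> S \<subseteq> L \<and> (\<forall>T\<subseteq>S. large T (S - T))" for S
  have step: "\<exists>x. x \<in> L - S \<and> indep (insert x S)" if S: "indep S" for S
  proof -
    define bad where
      "bad T = {x \<in> L. \<not> large (insert x T) (S - T)} \<union> {x \<in> L. \<not> large T (insert x (S - T))}" for T
    have "\<not> clusters_weakly_at_0 (bad T)" if "T \<subseteq> S" for T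
    proof -
      have T: "finite T" "T \<subseteq> L" "finite (S - T)" "S - T \<subseteq> L" "large T (S - T)"
        using S that by (auto simp: indep_def intro: finite_subset)
      show ?thesis
        using upper[OF T] lower[OF T(5)] unfolding bad_def by (blast dest: clusters_weakly_at_0_Un)
    qed
    then have "\<not> clusters_weakly_at_0 (\<Union>T\<in>Pow S. bad T)"
      using clusters_weakly_at_0_UN[of "Pow S" bad] S by (auto simp: indep_def)
    moreover have "\<not> clusters_weakly_at_0 S"
      using S L(1) nz by (intro finite_not_clusters_weakly_at_0) (auto simp: indep_def)
    \<comment> \<open>\<open>L\<close> clusters while the bad points together with \<open>S\<close>
      do not, so a fresh good point exists.\<close>
    ultimately have "\<not> L \<subseteq> (\<Union>T\<in>Pow S. bad T) \<union> S"
      using clusters_weakly_at_0_Un clusters_weakly_at_0_mono[OF L(2)] by metis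
    then obtain x where x: "x \<in> L" "x \<notin> S" "\<And>T. T \<subseteq> S \<Longrightarrow> x \<notin> bad T" by blast
    have "large T (insert x S - T)" if "T \<subseteq> insert x S" for T
    proof (cases "x \<in> T")
      case True
      then have "insert x (T - {x}) = T" "S - (T - {x}) = insert x S - T" using x(2) by auto
      then show ?thesis using x(1) x(3)[of "T - {x}"] that by (auto simp: bad_def)
    next
      case False
      then have "insert x (S - T) = insert x S - T" by auto
      then show ?thesis using x(1) x(3)[of T] that False by (auto simp: bad_def)
    qed
    then show ?thesis using x S by (auto simp: indep_def)
  qed
  have "indep {}"
    using none L by (simp add: indep_def large_def dual_region_def)
  \<comment> \<open>The conjunct for \<open>n = 0\<close> pins the initial set, since the choice
    principle returns only the invariant and the step relation.\<close>
  have "\<exists>S. \<forall>n. (indep (S n) \<and> (n = 0 \<longrightarrow> S n = {})) \<and> (\<exists>x. x \<in> L - S n \<and> S (Suc n) = insert x (S n))"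
    by (rule dependent_nat_choice) (use \<open>indep {}\<close> step in blast)+
  then obtain S where S: "\<And>n. indep (S n)" "S 0 = {}"
      "\<And>n. \<exists>x. x \<in> L - S n \<and> S (Suc n) = insert x (S n)" by blast
  then obtain x where x: "\<And>n. x n \<in> L" "\<And>n. x n \<notin> S n" "\<And>n. S (Suc n) = insert (x n) (S n)"
    by (metis DiffE)
  have S_eq: "S n = x ` {..<n}" for n
    by (induction n) (auto simp: S(2) x(3) lessThan_Suc)
  \<comment> \<open>Distinctness ensures that indices outside \<open>I\<close> give points outside
    the image of \<open>I\<close>.\<close>
  have inj: "x i \<noteq> x j" if "i < j" for i j
    using x(2)[of j] that unfolding S_eq by (metis imageI lessThan_iff)
  show thesis
  proof (rule that; (intro allI impI)?)
    show "range x \<subseteq> M" using x(1) L(1) by blast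
    fix n and I :: "nat set" assume "I \<subseteq> {..<n}"
    then have "x ` I \<subseteq> S n" by (auto simp: S_eq)
    then have "large (x ` I) (S n - x ` I)" using S(1)[of n] by (simp add: indep_def)
    then obtain \<phi> where \<phi>: "\<phi> \<in> dual_region a b (x ` I) (S n - x ` I)"
      unfolding large_def almost_below_def by blast
    have "x i \<in> S n - x ` I" if "i < n" "i \<notin> I" for i
      using that inj by (auto simp: S_eq) (metis linorder_neqE_nat)
    then show "\<exists>\<phi>\<in>dual_ball. \<forall>i<n. if i \<in> I then b \<le> \<phi> (x i) else \<phi> (x i) \<le> a"
      using \<phi> by (auto simp: dual_region_def)
  qed
qed

subsection \<open>Bounded sets in spaces without the sequence space\<close>

text \<open>Completeness makes the absolutely convergent sums define an operator on
  \<open>ell1\<close>. It is bounded below by \<open>d\<close>, so it is injective with a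
  \<open>1 / d\<close>-Lipschitz inverse on its range.\<close>

lemma contains_copy_of_ell1I:
  fixes x :: "nat \<Rightarrow> 'a::banach"
  assumes R: "\<And>i. norm (x i) \<le> R" and d: "0 < d"
    and lower: "\<And>n c. d * (\<Sum>i<n. \<bar>c i\<bar>) \<le> norm (\<Sum>i<n. c i *\<^sub>R x i)"
  shows "contains_copy_of_ell1 TYPE('a)"
proof -
  define T where "T z = (\<Sum>i. ell1_nth z i *\<^sub>R x i)" for z
  have bound: "norm (ell1_nth z i *\<^sub>R x i) \<le> R * \<bar>ell1_nth z i\<bar>" for z i
    using mult_right_mono[OF R[of i], of "\<bar>ell1_nth z i\<bar>"] by (simp add: mult.commute)
  have sumn: "summable (\<lambda>i. norm (ell1_nth z i *\<^sub>R x i))" for z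
    by (rule summable_comparison_test'[where g = "\<lambda>i. R * \<bar>ell1_nth z i\<bar>" and N = 0])
      (use bound in \<open>simp_all add: summable_abs_ell1_nth summable_mult\<close>)
  then have sum: "summable (\<lambda>i. ell1_nth z i *\<^sub>R x i)" for z by (rule summable_norm_cancel)
  have lin: "linear T"
  proof (rule linearI)
    fix z w c
    show "T (z + w) = T z + T w"
      unfolding T_def plus_ell1.rep_eq scaleR_add_left by (rule suminf_add[OF sum sum, symmetric])
    show "T (c *\<^sub>R z) = c *\<^sub>R T z"
      unfolding T_def scaleR_ell1.rep_eq scaleR_scaleR[symmetric]
      by (rule suminf_scaleR_right[OF sum, symmetric])
  qed
  have upperT: "norm (T z) \<le> norm z * R" for z
  proof -
    have "norm (T z) \<le> (\<Sum>i. norm (ell1_nth z i *\<^sub>R x i))"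
      unfolding T_def by (rule summable_norm[OF sumn])
    also have "\<dots> \<le> (\<Sum>i. R * \<bar>ell1_nth z i\<bar>)"
      by (intro suminf_le bound sumn summable_mult summable_abs_ell1_nth)
    also have "\<dots> = norm z * R"
      by (simp add: norm_ell1.rep_eq suminf_mult summable_abs_ell1_nth mult.commute)
    finally show ?thesis .
  qed
  have lowerT: "d * norm z \<le> norm (T z)" for z
  proof (rule LIMSEQ_le)
    show "(\<lambda>n. d * (\<Sum>i<n. \<bar>ell1_nth z i\<bar>)) \<longlonglongrightarrow> d * norm z"
      unfolding norm_ell1.rep_eq by (intro tendsto_mult_left summable_LIMSEQ summable_abs_ell1_nth)
    show "(\<lambda>n. norm (\<Sum>i<n. ell1_nth z i *\<^sub>R x i)) \<longlonglongrightarrow> norm (T z)"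
      unfolding T_def by (intro tendsto_norm summable_LIMSEQ sum)
  qed (use lower in blast)
  have lip: "dist z w \<le> (1 / d) * dist (T z) (T w)" for z w
    using lowerT[of "z - w"] d linear_diff[OF lin, of z w] by (simp add: dist_norm field_simps)
  then have "inj T" by (metis dist_eq_0_iff dist_le_zero_iff injI mult_zero_right)
  have "continuous_on UNIV T"
    using upperT linear_add[OF lin] linear_scale[OF lin]
    by (intro linear_continuous_on bounded_linear_intro[where K = R])
  moreover have "continuous_on (range T) (inv T)"
  proof (rule lipschitz_on_continuous_on)
    show "(1 / d)-lipschitz_on (range T) (inv T)"
      using lip d \<open>inj T\<close> by (intro lipschitz_onI) auto
  qed
  ultimately have "homeomorphism UNIV (range T) T (inv T)"
    using \<open>inj T\<close> by (auto simp: homeomorphism_def)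
  moreover have "subspace (range T)" using linear_subspace_image[OF lin subspace_UNIV] .
  ultimately show ?thesis unfolding contains_copy_of_ell1_def using lin by blast
qed

text \<open>Two functionals realise the sign pattern of \<open>c\<close> and its complement. Each
  term of their difference contributes at least \<open>(b - a) * \<bar>c i\<bar>\<close>, and the
  total is at most twice the norm.\<close>

lemma independent_imp_contains_copy_of_ell1:
  fixes x :: "nat \<Rightarrow> 'a::banach"
  assumes R: "\<And>i. norm (x i) \<le> R" and ab: "a < b"
    and indep: "\<forall>n. \<forall>I\<subseteq>{..<n}. \<exists>\<phi>\<in>dual_ball. \<forall>i<n. if i \<in> I then b \<le> \<phi> (x i) else \<phi> (x i) \<le> a"
  shows "contains_copy_of_ell1 TYPE('a)"
proof (rule contains_copy_of_ell1I[OF R])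
  show "0 < (b - a) / 2" using ab by simp
  fix n :: nat and c :: "nat \<Rightarrow> real"
  let ?y = "\<Sum>i<n. c i *\<^sub>R x i"
  obtain \<phi> where \<phi>: "\<phi> \<in> dual_ball"
      "\<And>i. i < n \<Longrightarrow> if 0 < c i then b \<le> \<phi> (x i) else \<phi> (x i) \<le> a"
    using indep[rule_format, of "{i. i < n \<and> 0 < c i}" n] by auto
  obtain \<psi> where \<psi>: "\<psi> \<in> dual_ball"
      "\<And>i. i < n \<Longrightarrow> if 0 < c i then \<psi> (x i) \<le> a else b \<le> \<psi> (x i)"
  proof -
    have "\<exists>\<psi>\<in>dual_ball. \<forall>i<n. if i \<in> {i. i < n \<and> c i \<le> 0} then b \<le> \<psi> (x i) else \<psi> (x i) \<le> a"
      by (rule indep[rule_format]) auto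
    then obtain \<psi> where "\<psi> \<in> dual_ball"
        "\<And>i. i < n \<Longrightarrow> if i \<in> {i. i < n \<and> c i \<le> 0} then b \<le> \<psi> (x i) else \<psi> (x i) \<le> a"
      by blast
    then show thesis by (intro that[of \<psi>]) (auto simp: not_le split: if_splits)
  qed
  have "(b - a) * \<bar>c i\<bar> \<le> c i * (\<phi> (x i) - \<psi> (x i))" if "i < n" for i
  proof (cases "0 < c i")
    case True
    then show ?thesis using \<phi>(2)[OF that] \<psi>(2)[OF that]
      by (simp add: mult.commute mult_left_mono)
  next
    case False
    then have "(- c i) * (b - a) \<le> (- c i) * (\<psi> (x i) - \<phi> (x i))"
      using \<phi>(2)[OF that] \<psi>(2)[OF that] by (intro mult_left_mono) auto
    then show ?thesis using False by (simp add: algebra_simps)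
  qed
  then have "(\<Sum>i<n. (b - a) * \<bar>c i\<bar>) \<le> (\<Sum>i<n. c i * (\<phi> (x i) - \<psi> (x i)))"
    by (intro sum_mono) auto
  also have "\<dots> = \<phi> ?y - \<psi> ?y"
    by (simp add: linear_sum[OF dual_ball_linear[OF \<phi>(1)]] linear_sum[OF dual_ball_linear[OF \<psi>(1)]]
        linear_scale[OF dual_ball_linear[OF \<phi>(1)]] linear_scale[OF dual_ball_linear[OF \<psi>(1)]]
        right_diff_distrib sum_subtractf)
  also have "\<dots> \<le> 2 * norm ?y"
  proof -
    have "\<bar>\<phi> ?y\<bar> \<le> norm ?y" "\<bar>\<psi> ?y\<bar> \<le> norm ?y" using \<phi>(1) \<psi>(1) by (auto simp: dual_ball_def)
    then show ?thesis by linarith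
  qed
  finally show "(b - a) / 2 * (\<Sum>i<n. \<bar>c i\<bar>) \<le> norm ?y"
    by (simp add: sum_distrib_left[symmetric])
qed

text \<open>Stated for bounded sets so that it also serves the balls of integer radius that cover
  the space.\<close>

lemma bounded_weakly_frechet_urysohn:
  fixes S :: "'a::banach set"
  assumes no: "\<not> contains_copy_of_ell1 TYPE('a)" and "bounded S"
  shows "weakly_frechet_urysohn S"
  unfolding weakly_frechet_urysohn_def frechet_urysohn_space_def
proof (intro allI impI)
  fix A x
  assume Ax: "A \<subseteq> topspace (subtopology weak_topology S) \<and> x \<in> subtopology weak_topology S closure_of A"
  then have AS: "A \<subseteq> S" and xS: "x \<in> S" by (auto simp: in_closure_of)
  have "\<exists>s. range s \<subseteq> A \<and> (\<forall>\<phi>\<in>dual_ball. (\<lambda>n. \<phi> (s n - x)) \<longlonglongrightarrow> 0)"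
  \<comment> \<open>If no functional separates some point of \<open>A\<close> from \<open>x\<close>,
    a constant sequence works; otherwise finite sets of differences never cluster.\<close>
  proof (cases "\<exists>a\<in>A. \<forall>\<phi>\<in>dual_ball. \<phi> (a - x) = 0")
    case True
    then obtain a where "a \<in> A" "\<And>\<phi>. \<phi> \<in> dual_ball \<Longrightarrow> \<phi> (a - x) = 0" by blast
    then show ?thesis by (intro exI[of _ "\<lambda>_. a"]) (auto intro: tendsto_eq_rhs[OF tendsto_const])
  next
    case False
    define M where "M = (\<lambda>a. a - x) ` A"
    have nz: "\<forall>y\<in>M. \<exists>\<phi>\<in>dual_ball. \<phi> y \<noteq> 0" using False by (auto simp: M_def)
    obtain R where R: "\<And>y. y \<in> M \<Longrightarrow> norm y \<le> R"
    proof -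
      have "bounded ((\<lambda>a. a - x) ` A)"
        using bounded_subset[OF \<open>bounded S\<close> AS] bounded_translation_minus by blast
      then show thesis using that by (auto simp: bounded_iff M_def)
    qed
    have M: "clusters_weakly_at_0 M"
      unfolding clusters_weakly_at_0_def
    proof (intro allI impI)
      fix \<Phi> :: "('a \<Rightarrow> real) set" and e :: real
      assume *: "finite \<Phi> \<and> \<Phi> \<subseteq> dual_ball \<and> 0 < e"
      then have "openin (subtopology weak_topology S) (weak_nbhd x \<Phi> e \<inter> S)"
        by (auto simp: openin_subtopology intro: openin_weak_nbhd)
      moreover have "x \<in> weak_nbhd x \<Phi> e \<inter> S"
        using * xS by (auto simp: weak_nbhd_def linear_0[OF dual_ball_linear] subset_iff)
      ultimately obtain a where "a \<in> A" "a \<in> weak_nbhd x \<Phi> e"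
        using Ax by (auto simp: in_closure_of)
      then show "\<exists>y\<in>M. \<forall>\<phi>\<in>\<Phi>. \<bar>\<phi> y\<bar> < e" by (auto simp: M_def weak_nbhd_def)
    qed
    \<comment> \<open>Failure at one \<open>e\<close> would give independence between the levels
      \<open>e / 2\<close> and \<open>e\<close>, hence a copy of \<open>ell1\<close>.\<close>
    have refine: "\<exists>N'\<subseteq>N. clusters_weakly_at_0 N' \<and> almost_below e N' dual_ball"
      if N: "N \<subseteq> M" "clusters_weakly_at_0 N" and e: "0 < e" for N e
    proof (rule ccontr)
      assume "\<not> ?thesis"
      then have none: "\<forall>N'\<subseteq>N. clusters_weakly_at_0 N' \<longrightarrow> \<not> almost_below e N' dual_ball" by blast
      have nzN: "\<forall>y\<in>N. \<exists>\<phi>\<in>dual_ball. \<phi> y \<noteq> 0" using N(1) nz by blast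
      have "0 < e / 2" using e by simp
      then obtain y :: "nat \<Rightarrow> 'a" where y: "range y \<subseteq> N"
        "\<forall>n. \<forall>I\<subseteq>{..<n}. \<exists>\<phi>\<in>dual_ball. \<forall>i<n. if i \<in> I then e \<le> \<phi> (y i) else \<phi> (y i) \<le> e / 2"
        by (rule independent_sequence[OF N(2) nzN none])
      have "contains_copy_of_ell1 TYPE('a)"
      proof (rule independent_imp_contains_copy_of_ell1[OF _ _ y(2)])
        show "norm (y i) \<le> R" for i using y(1) N(1) R by blast
      qed (use e in auto)
      then show False using no by blast
    qed
    have "\<exists>f. \<forall>n. (clusters_weakly_at_0 (f n) \<and> f n \<subseteq> M) \<and>
        (f (Suc n) \<subseteq> f n \<and> almost_below (1 / Suc n) (f (Suc n)) dual_ball)"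
    proof (rule dependent_nat_choice)
      show "\<exists>N. clusters_weakly_at_0 N \<and> N \<subseteq> M" using M by blast
      show "\<exists>N'. (clusters_weakly_at_0 N' \<and> N' \<subseteq> M) \<and> (N' \<subseteq> N \<and> almost_below (1 / Suc n) N' dual_ball)"
        if N: "clusters_weakly_at_0 N \<and> N \<subseteq> M" for N n
      proof -
        obtain N' where "N' \<subseteq> N" "clusters_weakly_at_0 N'" "almost_below (1 / Suc n) N' dual_ball"
          using refine[of N "1 / Suc n"] N by auto
        then show ?thesis using N by blast
      qed
    qed
    then obtain f where f: "\<And>n. clusters_weakly_at_0 (f n)" "\<And>n. f n \<subseteq> M"
        "\<And>n. f (Suc n) \<subseteq> f n" "\<And>n. almost_below (1 / Suc n) (f (Suc n)) dual_ball"
      by blast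
    then obtain L where L: "clusters_weakly_at_0 L" "L \<subseteq> f 0" "countable L" "\<And>n. finite (L - f n)"
      using clusters_weakly_at_0_pseudo_intersection[of f] by (metis decseq_SucI)
    have LM: "L \<subseteq> M" using L(2) f(2) by blast
    have "infinite L"
      using L(1) finite_not_clusters_weakly_at_0[of L] LM nz by blast
    \<comment> \<open>Enumeration without repetition turns finitely many exceptional points into
      finitely many exceptional indices.\<close>
    define l where "l = from_nat_into L"
    have l: "bij_betw l UNIV L"
      unfolding l_def using L(3) \<open>infinite L\<close> by (rule bij_betw_from_nat_into)
    have below: "\<forall>\<^sub>F n in sequentially. \<phi> (l n) < e" if \<phi>: "\<phi> \<in> dual_ball" and "0 < e" for \<phi> e
    proof -
      obtain k where k: "1 / Suc k < e" using \<open>0 < e\<close> nat_approx_posE by blast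
      have "almost_below (1 / Suc k) L dual_ball"
        using f(4)[of k] L(4)[of "Suc k"] by (rule almost_below_finite_Diff)
      then have "finite {y \<in> L. 1 / Suc k \<le> \<phi> y}" using \<phi> by (simp add: almost_below_def)
      then have "finite (l -` {y \<in> L. 1 / Suc k \<le> \<phi> y})"
        using l by (intro finite_vimageI) (auto simp: bij_betw_def)
      moreover have "l -` {y \<in> L. 1 / Suc k \<le> \<phi> y} = {n. \<not> \<phi> (l n) < 1 / Suc k}"
        using l by (auto simp: bij_betw_def)
      ultimately have "\<forall>\<^sub>F n in cofinite. \<phi> (l n) < 1 / Suc k"
        by (simp add: eventually_cofinite)
      then show ?thesis
        unfolding cofinite_eq_sequentially by eventually_elim (use k in linarith)
    qed
    have "(\<lambda>n. \<phi> (l n)) \<longlonglongrightarrow> 0" if \<phi>: "\<phi> \<in> dual_ball" for \<phi>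
    proof (rule tendstoI)
      fix e :: real assume "0 < e"
      from below[OF \<phi> this] below[OF dual_ball_uminus[OF \<phi>] this]
      show "\<forall>\<^sub>F n in sequentially. dist (\<phi> (l n)) 0 < e"
        by eventually_elim (simp add: abs_less_iff)
    qed
    moreover have "l n + x \<in> A" for n
    proof -
      have "l n \<in> M" using l LM by (auto simp: bij_betw_def)
      then show ?thesis by (auto simp: M_def)
    qed
    then have "range (\<lambda>n. l n + x) \<subseteq> A" by blast
    ultimately show ?thesis by (intro exI[of _ "\<lambda>n. l n + x"]) simp
  qed
  then obtain s where s: "range s \<subseteq> A" "\<forall>\<phi>\<in>dual_ball. (\<lambda>n. \<phi> (s n - x)) \<longlonglongrightarrow> 0" by blast
  then have "s n \<in> S" for n using AS by blast
  with s xS show "\<exists>s. range s \<subseteq> A \<and> limitin (subtopology weak_topology S) s x sequentially"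
    by (intro exI[of _ s]) (simp add: limitin_subtopology limitin_weak_iff)
qed

subsection \<open>Balls in spaces containing the sequence space\<close>

lift_definition ell1_unit :: "nat \<Rightarrow> ell1" is "\<lambda>i n. if n = i then 1 else 0"
  by (rule summable_finite[of "{i}" for i]) auto

lift_definition ell1_sum_on :: "nat set \<Rightarrow> ell1 \<Rightarrow> real" is "\<lambda>S z. \<Sum>n. of_bool (n \<in> S) * z n" .

lemma norm_ell1_unit: "norm (ell1_unit i) = 1"
proof transfer
  fix i :: nat
  have "(\<Sum>n. \<bar>if n = i then 1 else 0 :: real\<bar>) = (\<Sum>n\<in>{i}. \<bar>if n = i then 1 else 0\<bar>)"
    by (rule suminf_finite) auto
  then show "(\<Sum>n. \<bar>if n = i then 1 else 0 :: real\<bar>) = 1" by simp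
qed

lemma ell1_sum_on_unit: "ell1_sum_on S (ell1_unit i) = of_bool (i \<in> S)"
proof transfer
  fix S :: "nat set" and i
  have "(\<Sum>n. of_bool (n \<in> S) * (if n = i then 1 else 0 :: real)) =
      (\<Sum>n\<in>{i}. of_bool (n \<in> S) * (if n = i then 1 else 0))"
    by (rule suminf_finite) auto
  then show "(\<Sum>n. of_bool (n \<in> S) * (if n = i then 1 else 0 :: real)) = of_bool (i \<in> S)" by simp
qed

lemma summable_of_bool_mult:
  fixes z :: "nat \<Rightarrow> real"
  assumes "summable (\<lambda>n. \<bar>z n\<bar>)"
  shows "summable (\<lambda>n. \<bar>of_bool (n \<in> S) * z n\<bar>)" "summable (\<lambda>n. of_bool (n \<in> S) * z n)"
proof -
  show "summable (\<lambda>n. \<bar>of_bool (n \<in> S) * z n\<bar>)"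
    by (rule summable_comparison_test'[OF assms, where N = 0]) auto
  then show "summable (\<lambda>n. of_bool (n \<in> S) * z n)" by (rule summable_rabs_cancel)
qed

lemma linear_ell1_sum_on: "linear (ell1_sum_on S)"
proof (rule linearI)
  fix z w :: ell1 and c :: real
  show "ell1_sum_on S (z + w) = ell1_sum_on S z + ell1_sum_on S w"
    by transfer (simp add: distrib_left suminf_add summable_of_bool_mult)
  show "ell1_sum_on S (c *\<^sub>R z) = c *\<^sub>R ell1_sum_on S z"
    by transfer (simp add: mult.left_commute suminf_mult summable_of_bool_mult)
qed

lemma abs_ell1_sum_on_le: "\<bar>ell1_sum_on S z\<bar> \<le> norm z"
proof transfer
  fix S and z :: "nat \<Rightarrow> real"
  assume z: "summable (\<lambda>n. \<bar>z n\<bar>)"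
  have "\<bar>\<Sum>n. of_bool (n \<in> S) * z n\<bar> \<le> (\<Sum>n. \<bar>of_bool (n \<in> S) * z n\<bar>)"
    by (rule summable_rabs[OF summable_of_bool_mult(1)[OF z]])
  also have "\<dots> \<le> (\<Sum>n. \<bar>z n\<bar>)"
    by (rule suminf_le[OF _ summable_of_bool_mult(1)[OF z] z]) auto
  finally show "\<bar>\<Sum>n. of_bool (n \<in> S) * z n\<bar> \<le> (\<Sum>n. \<bar>z n\<bar>)" .
qed

text \<open>Turns continuity at the origin into a norm inequality. It is used with \<open>f\<close>
  and the identity in both roles, giving two-sided estimates for the embedding.\<close>

lemma linear_norm_comparison:
  fixes f :: "'b::real_vector \<Rightarrow> 'a::real_normed_vector" and h :: "'b \<Rightarrow> 'c::real_normed_vector"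
  assumes "linear f" "linear h" "0 < d" and small: "\<And>z. norm (f z) < d \<Longrightarrow> norm (h z) \<le> 1"
  shows "norm (h z) \<le> 2 / d * norm (f z)"
proof (rule ccontr)
  assume "\<not> ?thesis"
  then have gt: "2 / d * norm (f z) < norm (h z)" by simp
  moreover have "0 \<le> 2 / d * norm (f z)" using \<open>0 < d\<close> by simp
  ultimately have pos: "0 < norm (h z)" by linarith
  \<comment> \<open>The rescaled vector has an \<open>h\<close>-image of norm 2, while its
    \<open>f\<close>-image stays inside radius \<open>d\<close>.\<close>
  define t where "t = 2 / norm (h z)"
  have "norm (f (t *\<^sub>R z)) < d"
    using gt pos \<open>0 < d\<close> \<open>linear f\<close> by (simp add: linear_scale t_def field_simps)
  then have "norm (h (t *\<^sub>R z)) \<le> 1" by (rule small)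
  then show False using pos \<open>linear h\<close> by (simp add: linear_scale t_def)
qed

text \<open>Some \<open>S\<close> separates the endpoints of infinitely many edges \<open>{i n, j n}\<close>: otherwise every
  vertex lies on finitely many edges, and the left endpoints of a sparse subsequence form such
  an \<open>S\<close>.\<close>

lemma edges_infinitely_often_separated:
  fixes i j :: "nat \<Rightarrow> nat"
  assumes less: "\<And>n. i n < j n"
  obtains S where "\<exists>\<^sub>F n in sequentially. i n \<in> S \<and> j n \<notin> S"
proof (rule ccontr)
  assume no: "\<not> thesis"
  then have ev: "\<forall>\<^sub>F n in sequentially. i n \<in> S \<longrightarrow> j n \<in> S" for S
    using that[of S] by (auto simp: frequently_def)
  \<comment> \<open>With \<open>S\<close> a singleton, \<open>i n = m\<close> would eventually force
    \<open>j n = m\<close>, against \<open>i n < j n\<close>.\<close>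
  have "\<forall>\<^sub>F n in sequentially. i n \<noteq> m" for m
    using ev[of "{m}"] by eventually_elim (metis less less_irrefl singleton_iff)
  then have "\<forall>\<^sub>F n in sequentially. \<forall>k\<in>{..m}. i n \<noteq> k" for m
    by (intro eventually_ball_finite) auto
  then have large: "\<forall>\<^sub>F n in sequentially. m < i n" for m
    by (rule eventually_mono[where P = "\<lambda>n. \<forall>k\<in>{..m}. i n \<noteq> k"]) (metis atMost_iff not_le_imp_less)
  \<comment> \<open>Along this subsequence the intervals from \<open>i\<close> to \<open>j\<close>
    are disjoint and ordered, so no right endpoint is a left endpoint.\<close>
  have "\<exists>r. \<forall>k. True \<and> (r k < r (Suc k) \<and> j (r k) < i (r (Suc k)))"
  proof (rule dependent_nat_choice)
    fix n k :: nat
    have "\<forall>\<^sub>F n' in sequentially. n < n' \<and> j n < i n'"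
      using large[of "j n"] eventually_gt_at_top[of n] by eventually_elim simp
    then show "\<exists>n'. True \<and> (n < n' \<and> j n < i n')" by (auto simp: eventually_at_top_linorder)
  qed simp
  then obtain r where r: "\<And>k. r k < r (Suc k)" "\<And>k. j (r k) < i (r (Suc k))" by blast
  have "strict_mono r" using r(1) by (simp add: strict_mono_Suc_iff)
  have "i (r k) < i (r (Suc k))" for k using less[of "r k"] r(2)[of k] by linarith
  then have smi: "strict_mono (\<lambda>k. i (r k))" by (simp add: strict_mono_Suc_iff)
  define S where "S = range (\<lambda>k. i (r k))"
  have "j (r k) \<notin> S" for k
  proof
    assume "j (r k) \<in> S"
    then obtain l where l: "j (r k) = i (r l)" by (auto simp: S_def)
    then have "i (r k) < i (r l)" "i (r l) < i (r (Suc k))" using less[of "r k"] r(2)[of k] by auto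
    then have "k < l" "l < Suc k" using strict_mono_less[OF smi] by auto
    then show False by simp
  qed
  moreover have "\<forall>\<^sub>F k in sequentially. i (r k) \<in> S \<longrightarrow> j (r k) \<in> S"
    using eventually_subseq[OF \<open>strict_mono r\<close> ev] .
  ultimately have "\<forall>\<^sub>F k in sequentially. False" by (simp add: S_def)
  then show False by simp
qed

text \<open>Pigeonhole: rounding the values on \<open>\<Phi>\<close> in steps of \<open>e\<close>
  leaves finitely many codes, and equal codes mean values closer than \<open>e\<close>.\<close>

lemma finite_functionals_almost_equal:
  fixes u :: "nat \<Rightarrow> 'a::real_normed_vector"
  assumes "finite \<Phi>" "\<Phi> \<subseteq> dual_ball" "0 < e" and R: "\<And>i. norm (u i) \<le> R"
  obtains i j where "i < j" "\<And>\<phi>. \<phi> \<in> \<Phi> \<Longrightarrow> \<bar>\<phi> (u i - u j)\<bar> < e"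
proof -
  define c where "c i = restrict (\<lambda>\<phi>. \<lfloor>\<phi> (u i) / e\<rfloor>) \<Phi>" for i
  have "c i \<in> (\<Pi>\<^sub>E \<phi>\<in>\<Phi>. {\<lfloor>- R / e\<rfloor>..\<lfloor>R / e\<rfloor>})" for i
  proof -
    have "\<lfloor>- R / e\<rfloor> \<le> \<lfloor>\<phi> (u i) / e\<rfloor> \<and> \<lfloor>\<phi> (u i) / e\<rfloor> \<le> \<lfloor>R / e\<rfloor>" if "\<phi> \<in> \<Phi>" for \<phi>
    proof -
      have "\<bar>\<phi> (u i)\<bar> \<le> norm (u i)" using that assms(2) by (auto simp: dual_ball_def)
      then have "- R \<le> \<phi> (u i)" "\<phi> (u i) \<le> R" using R[of i] by linarith+
      then show ?thesis using \<open>0 < e\<close> by (intro conjI floor_mono divide_right_mono) auto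
    qed
    then show ?thesis by (auto simp: c_def)
  qed
  then have "finite (range c)"
    by (intro finite_subset[OF _ finite_PiE[of \<Phi> "\<lambda>_. {\<lfloor>- R / e\<rfloor>..\<lfloor>R / e\<rfloor>}"]]) (use assms(1) in auto)
  then have "\<not> inj c" using finite_imageD by auto
  then obtain k l where "k \<noteq> l" "c k = c l" by (auto simp: inj_def)
  then obtain i j where ij: "i < j" "c i = c j" by (metis linorder_neqE_nat)
  show thesis
  proof (rule that[OF ij(1)])
    fix \<phi> assume \<phi>: "\<phi> \<in> \<Phi>"
    then have "\<lfloor>\<phi> (u i) / e\<rfloor> = \<lfloor>\<phi> (u j) / e\<rfloor>" using fun_cong[OF ij(2), of \<phi>] by (simp add: c_def)
    then have "\<bar>\<phi> (u i) / e - \<phi> (u j) / e\<bar> < 1" by linarith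
    then have "\<bar>\<phi> (u i) - \<phi> (u j)\<bar> < e"
      using \<open>0 < e\<close> by (simp add: abs_divide flip: diff_divide_distrib)
    moreover have "linear \<phi>" using \<phi> assms(2) dual_ball_linear by blast
    ultimately show "\<bar>\<phi> (u i - u j)\<bar> < e" by (simp add: linear_diff)
  qed
qed

text \<open>The ball is arbitrary because Baire's theorem only produces some ball. Scaled
  differences of embedded unit vectors refute the property at its centre.\<close>

lemma contains_copy_of_ell1_imp_cball_not_weakly_frechet_urysohn:
  fixes x :: "'a::real_normed_vector"
  assumes copy: "contains_copy_of_ell1 TYPE('a)" and "0 < r"
  shows "\<not> weakly_frechet_urysohn (cball x r)"
proof
  assume FU: "weakly_frechet_urysohn (cball x r)"
  obtain Y and f :: "ell1 \<Rightarrow> 'a" and g where f: "linear f" and hom: "homeomorphism UNIV Y f g"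
    using copy unfolding contains_copy_of_ell1_def by blast
  have f0: "f 0 = 0" using f by (rule linear_0)
  have "continuous_on UNIV f" "continuous_on Y g" and gf: "\<And>z. g (f z) = z" "\<And>z. f z \<in> Y"
    using hom by (auto simp: homeomorphism_def)
  obtain d where d: "0 < d" "\<And>z. norm z < d \<Longrightarrow> norm (f z) \<le> 1"
  proof -
    obtain d where "0 < d" "\<And>z. dist z 0 < d \<Longrightarrow> dist (f z) (f 0) < 1"
      using \<open>continuous_on UNIV f\<close> unfolding continuous_on_iff by (metis UNIV_I zero_less_one)
    then show thesis using that[of d] by (simp add: f0 less_imp_le)
  qed
  obtain d' where d': "0 < d'" "\<And>z. norm (f z) < d' \<Longrightarrow> norm z \<le> 1"
  proof -
    obtain d where "0 < d" "\<And>y. y \<in> Y \<Longrightarrow> dist y (f 0) < d \<Longrightarrow> dist (g y) (g (f 0)) < 1"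
      using \<open>continuous_on Y g\<close> gf(2) unfolding continuous_on_iff by (metis zero_less_one)
    then have "dist (g (f z)) (g (f 0)) < 1" if "norm (f z) < d" for z
      using that gf(2) by (simp add: f0)
    then show thesis using that[of d] \<open>0 < d\<close> by (simp add: gf(1) less_imp_le)
  qed
  \<comment> \<open>The embedding has norm at most \<open>2 / d\<close>, so this factor keeps each
    \<open>u i\<close> within \<open>r / 2\<close> and differences within \<open>r\<close>.\<close>
  define u where "u i = (r * d / 4) *\<^sub>R f (ell1_unit i)" for i
  have norm_u: "norm (u i) \<le> r / 2" for i
  proof -
    have "norm (f (ell1_unit i)) \<le> 2 / d * norm (ell1_unit i)"
      using linear_norm_comparison[OF linear_ident f d(1), of "ell1_unit i"] d(2) by simp
    then have "(r * d / 4) * norm (f (ell1_unit i)) \<le> (r * d / 4) * (2 / d)"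
      using d(1) \<open>0 < r\<close> by (intro mult_left_mono) (auto simp: norm_ell1_unit)
    then show ?thesis using d(1) \<open>0 < r\<close> by (simp add: u_def)
  qed
  define A where "A = {x + (u i - u j) | i j. i < j}"
  have "norm (u i - u j) \<le> r" for i j
    using norm_triangle_ineq4[of "u i" "u j"] norm_u[of i] norm_u[of j] by linarith
  then have A: "A \<subseteq> cball x r" by (auto simp: A_def dist_norm norm_minus_commute)
  have "x \<in> subtopology weak_topology (cball x r) closure_of A"
    unfolding in_closure_of
  proof (intro conjI allI impI)
    show "x \<in> topspace (subtopology weak_topology (cball x r))" using \<open>0 < r\<close> by simp
    fix T assume "x \<in> T \<and> openin (subtopology weak_topology (cball x r)) T"
    then obtain U where U: "openin weak_topology U" "T = U \<inter> cball x r" "x \<in> U"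
      by (auto simp: openin_subtopology)
    then obtain \<Phi> e where \<Phi>: "finite \<Phi>" "\<Phi> \<subseteq> dual_ball" "0 < e" "weak_nbhd x \<Phi> e \<subseteq> U"
      using openin_weak_imp_nbhd by blast
    obtain i j where ij: "i < j" "\<And>\<phi>. \<phi> \<in> \<Phi> \<Longrightarrow> \<bar>\<phi> (u i - u j)\<bar> < e"
      using finite_functionals_almost_equal[where u = u, OF \<Phi>(1-3) norm_u] by metis
    have "x + (u i - u j) \<in> weak_nbhd x \<Phi> e" using ij(2) by (simp add: weak_nbhd_def)
    moreover have "x + (u i - u j) \<in> A" using ij(1) by (auto simp: A_def)
    ultimately show "\<exists>y. y \<in> A \<and> y \<in> T" using U(2) \<Phi>(4) A by blast
  qed
  then obtain s where s: "range s \<subseteq> A" "limitin weak_topology s x sequentially"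
    using FU A unfolding weakly_frechet_urysohn_def frechet_urysohn_space_def limitin_subtopology
      topspace_subtopology topspace_weak_topology Int_UNIV_left by blast
  have "\<exists>i j. i < j \<and> s n = x + (u i - u j)" for n using s(1) unfolding A_def by blast
  then obtain i j where ij: "\<And>n. i n < j n" "\<And>n. s n = x + (u (i n) - u (j n))" by metis
  obtain S where S: "\<exists>\<^sub>F n in sequentially. i n \<in> S \<and> j n \<notin> S"
    by (rule edges_infinitely_often_separated[of i j, OF ij(1)])
  have le: "\<bar>ell1_sum_on S z\<bar> \<le> 2 / d' * norm (f z)" for z
    using abs_ell1_sum_on_le linear_norm_comparison[OF f linear_ident d'] by (rule order_trans)
  have "0 \<le> 2 / d'" using d'(1) by simp
  \<comment> \<open>The indicator functional of \<open>S\<close> is bounded on the copy because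
    \<open>f\<close> is bounded below, so it extends to the whole space.\<close>
  then obtain \<phi> where \<phi>: "linear \<phi>" "\<And>z. \<phi> (f z) = ell1_sum_on S z" "\<And>y. \<bar>\<phi> y\<bar> \<le> 2 / d' * norm y"
    using hahn_banach_extension[OF f linear_ell1_sum_on le] by metis
  have "bounded_linear \<phi>"
    using \<phi>(1,3) by (intro bounded_linear_intro[where K = "2 / d'"]) (auto simp: linear_add linear_scale mult.commute)
  then obtain c \<psi> where \<psi>: "\<psi> \<in> dual_ball" "\<phi> = (\<lambda>x. c * \<psi> x)"
    using bounded_linear_multiple_dual_ball by blast
  have "(\<lambda>n. c * \<psi> (s n - x)) \<longlonglongrightarrow> c * 0"
    using s(2) \<psi>(1) by (intro tendsto_mult_left) (simp add: limitin_weak_iff)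
  then have "(\<lambda>n. \<phi> (s n - x)) \<longlonglongrightarrow> 0" by (simp add: \<psi>(2))
  then have close: "\<forall>\<^sub>F n in sequentially. \<bar>\<phi> (s n - x)\<bar> < r * d / 4"
    using d(1) \<open>0 < r\<close> by (auto dest: tendstoD[where e = "r * d / 4"])
  \<comment> \<open>The functional sees only the first of the two unit vectors, so it takes this
    constant infinitely often although weak convergence sends it to 0.\<close>
  have far: "\<phi> (s n - x) = r * d / 4" if "i n \<in> S \<and> j n \<notin> S" for n
    using that \<phi>(1,2) by (simp add: ij(2) u_def linear_diff linear_scale ell1_sum_on_unit)
  from close have "\<forall>\<^sub>F n in sequentially. \<not> (i n \<in> S \<and> j n \<notin> S)"
  proof (rule eventually_mono)
    fix n assume "\<bar>\<phi> (s n - x)\<bar> < r * d / 4"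
    then show "\<not> (i n \<in> S \<and> j n \<notin> S)" using far[of n] by linarith
  qed
  then show False using S by (simp add: frequently_def)
qed

text \<open>Baire: if all sets of the cover had empty interior, so would their union, which is the
  whole space.\<close>

lemma closed_cover_contains_cball:
  fixes F :: "nat \<Rightarrow> 'a::banach set"
  assumes cl: "\<And>n. closed (F n)" and cover: "(\<Union>n. F n) = UNIV"
  obtains n x r where "0 < r" "cball x r \<subseteq> F n"
proof -
  have "\<exists>n. interior (F n) \<noteq> {}"
  proof (rule ccontr)
    assume "\<not> ?thesis"
    then have "Met_TC.mtopology interior_of \<Union>(range F) = ({} :: 'a set)"
      using cl by (intro Met_TC.metric_Baire_category_alt) (auto simp: mcomplete_iff_complete complete_UNIV)
    then show False using cover by simp
  qed
  then obtain n x where "x \<in> interior (F n)" by blast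
  then show thesis using that by (meson interior_subset mem_interior_cball)
qed

theorem corollary4p5:
  shows "((\<not> contains_copy_of_ell1 TYPE('a::banach)) \<longleftrightarrow>
            weakly_frechet_urysohn (cball (0::'a) 1)) \<and>
         (weakly_frechet_urysohn (cball (0::'a) 1) \<longleftrightarrow>
            (\<exists>F :: nat \<Rightarrow> 'a set.
               (\<forall>n. closedin weak_topology (F n) \<and> weakly_frechet_urysohn (F n)) \<and>
               (\<Union>n. F n) = UNIV))"
proof -
  let ?cover = "\<lambda>F :: nat \<Rightarrow> 'a set.
    (\<forall>n. closedin weak_topology (F n) \<and> weakly_frechet_urysohn (F n)) \<and> (\<Union>n. F n) = UNIV"
  have 1: "weakly_frechet_urysohn (cball (0::'a) 1)" if "\<not> contains_copy_of_ell1 TYPE('a)"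
    using that by (rule bounded_weakly_frechet_urysohn) simp
  have 2: "\<not> contains_copy_of_ell1 TYPE('a)" if "weakly_frechet_urysohn (cball (0::'a) 1)"
    using that contains_copy_of_ell1_imp_cball_not_weakly_frechet_urysohn[of 1 "0::'a"] by auto
  have 3: "\<exists>F. ?cover F" if "\<not> contains_copy_of_ell1 TYPE('a)"
  proof (rule exI[of _ "\<lambda>n. cball 0 (real n)"], intro conjI allI)
    fix n
    show "closedin weak_topology (cball (0::'a) (real n))" by (rule weakly_closed_cball)
    show "weakly_frechet_urysohn (cball (0::'a) (real n))"
      using that by (rule bounded_weakly_frechet_urysohn) simp
  next
    show "(\<Union>n. cball (0::'a) (real n)) = UNIV" using real_arch_simple by auto
  qed
  \<comment> \<open>Some \<open>F n\<close> contains a norm ball, which inherits the property; a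
    copy of \<open>ell1\<close> excludes this for every ball.\<close>
  have 4: "\<not> contains_copy_of_ell1 TYPE('a)" if "?cover F" for F
  proof -
    have closed: "closed (F n)" for n using that weakly_closed_imp_closed by blast
    have cover: "(\<Union>n. F n) = UNIV" using that by blast
    obtain n x r where r: "0 < r" "cball x r \<subseteq> F n"
      by (rule closed_cover_contains_cball[of F, OF closed cover])
    have "weakly_frechet_urysohn (cball x r)"
      using that r(2) frechet_urysohn_subtopology unfolding weakly_frechet_urysohn_def by blast
    then show ?thesis
      using contains_copy_of_ell1_imp_cball_not_weakly_frechet_urysohn[OF _ r(1)] by blast
  qed
  show ?thesis using 1 2 3 4 by blast
qed

end
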